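(* For $n\ge0$ let $p_n=\prod_{m=0}^{n-1}\big(y-c+\tfrac{m(m+1)}2\big)\in\mathcal S$ (product in the cross-product algebra). Then $\{p_n\}_{n\ge0}$ is a basis of the free $\mathbb C[c]$-module $\mathcal S$ and $\langle p_n,p_k\rangle=0$ for all $n\ne k$.
   Context: Let $x_1=\tfrac12\begin{pmatrix}0&1\\1&0\end{pmatrix}$, $x_2=\tfrac12\begin{pmatrix}0&-i\\ i&0\end{pmatrix}$, $x_3=\tfrac12\begin{pmatrix}1&0\\0&-1\end{pmatrix}$, $c=x_1^2+x_2^2+x_3^2$. For a chord diagram $D$ (oriented circle with $2n$ points paired into chords, up to orientation-preserving diffeomorphism), $w_{\mathfrak{sl}_2}(D)=\sum_\varphi x_{\varphi(p_1)}\cdots x_{\varphi(p_{2n})}\in\mathbb C[c]$, $p_i$ the endpoints in order from a cut point and $\varphi$ over maps chords$\to\{1,2,3\}$. A share: two oriented intervals (strand 1, strand 2) with finitely many chords (disjoint pairs of distinct points), up to orientation-preserving diffeomorphisms of each strand; arches have both ends on one strand, bridges one end on each. $A_2$ = $\mathbb C$-span of shares. Join $(I,H)$: chord diagram whose circle reads strand 1 of $I$, strand 1 of $H$, strand 2 of $I$, strand 2 of $H$ (bilinear). $I\sim I'$ iff $w_{\mathfrak{sl}_2}((I,H))=w_{\mathfrak{sl}_2}((I',H))$ for all shares $H$; $\mathcal S=A_2/\!\sim$. Cross product $I\times H$: strand 1 is strand 1 of $I$ followed by strand 1 of $H$, strand 2 is strand 2 of $H$ followed by strand 2 of $I$; it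 makes $\mathcal S$ a commutative $\mathbb C[c]$-algebra isomorphic to $\mathbb C[c][y]$, where $c$ is the class of the share with one arch and $y$ the class of the share with one bridge; $y^m$ is the class of the share with $m$ bridges $b_1,\dots,b_m$ in order $b_1,\dots,b_m$ on strand 1 and $b_m,\dots,b_1$ on strand 2. The $\mathbb C[c]$-bilinear form on $\mathcal S$ is $\langle I,H\rangle=w_{\mathfrak{sl}_2}((I,H))$. *)

theory Defs
  imports Complex_Main "HOL-Library.Poly_Mapping" "HOL-Computational_Algebra.Polynomial"
    "HOL-Library.FuncSet"
begin

text \<open>Matrices are functions nat => nat => complex, meaningful on indices < d.
  In the d-dimensional irreducible representation of sl2 (spin j = (d-1)/2, basis
  index a corresponds to weight m = j - a) we use J_+, J_-, J_z and put
  x1 = (J_+ + J_-)/2, x2 = (J_+ - J_-)/(2i), x3 = J_z. For d = 2 these are exactly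
  the matrices x1, x2, x3 of the paper; the Casimir c = x1^2+x2^2+x3^2 acts by
  j(j+1) = (d^2-1)/4.\<close>

type_synonym cmat = "nat \<Rightarrow> nat \<Rightarrow> complex"

definition jplus :: "nat \<Rightarrow> cmat" where
  "jplus d i k = (if k < d \<and> i + 1 = k then complex_of_real (sqrt (real k * real (d - k))) else 0)"

definition jminus :: "nat \<Rightarrow> cmat" where
  "jminus d i k = jplus d k i"

definition jz :: "nat \<Rightarrow> cmat" where
  "jz d i k = (if i = k \<and> i < d then complex_of_real ((real d - 1) / 2 - real i) else 0)"

definition xgen :: "nat \<Rightarrow> nat \<Rightarrow> cmat" where
  "xgen d a = (if a = 1 then (\<lambda>i k. (jplus d i k + jminus d i k) / 2)
               else if a = 2 then (\<lambda>i k. (jplus d i k - jminus d i k) / (2 * \<i>))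
               else jz d)"

definition mmul :: "nat \<Rightarrow> cmat \<Rightarrow> cmat \<Rightarrow> cmat" where
  "mmul d A B = (\<lambda>i k. \<Sum>j<d. A i j * B j k)"

definition mid :: "nat \<Rightarrow> cmat" where
  "mid d = (\<lambda>i k. if i = k \<and> i < d then 1 else 0)"

text \<open>A chord diagram is given by the word of chord labels read along the circle from a
  cut point (each label occurring exactly twice).\<close>

definition wordmat :: "nat \<Rightarrow> (nat \<Rightarrow> nat) \<Rightarrow> nat list \<Rightarrow> cmat" where
  "wordmat d \<phi> w = foldr (\<lambda>l M. mmul d (xgen d (\<phi> l)) M) w (mid d)"

definition sl2sum :: "nat \<Rightarrow> nat list \<Rightarrow> cmat" where
  "sl2sum d w = (\<lambda>i k. \<Sum>\<phi>\<in>(set w \<rightarrow>\<^sub>E {1,2,3}). wordmat d \<phi> w i k)"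

definition casimir_val :: "nat \<Rightarrow> complex" where
  "casimir_val d = ((of_nat d)^2 - 1) / 4"

text \<open>w_sl2(D) in C[c]: the polynomial P such that the element
  sum_phi x_phi(p1) ... x_phi(p2n) of U(sl2) acts as P(c) in every finite-dimensional
  irreducible representation.\<close>

definition w_sl2 :: "nat list \<Rightarrow> complex poly" where
  "w_sl2 w = (THE P. \<forall>d\<ge>1. \<forall>i<d. \<forall>k<d.
      sl2sum d w i k = (if i = k then poly P (casimir_val d) else 0))"

type_synonym share = "nat list \<times> nat list"

definition wf_share :: "share \<Rightarrow> bool" where
  "wf_share s = (\<forall>l \<in> set (fst s @ snd s). count_list (fst s @ snd s) l = 2)"

definition lab1 :: "nat \<Rightarrow> nat" where "lab1 l = 2 * l"
definition lab2 :: "nat \<Rightarrow> nat" where "lab2 l = 2 * l + 1"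

definition join_share :: "share \<Rightarrow> share \<Rightarrow> nat list" where
  "join_share I H = map lab1 (fst I) @ map lab2 (fst H) @ map lab1 (snd I) @ map lab2 (snd H)"

definition cross_share :: "share \<Rightarrow> share \<Rightarrow> share" where
  "cross_share I H = (map lab1 (fst I) @ map lab2 (fst H), map lab2 (snd H) @ map lab1 (snd I))"

type_synonym a2 = "share \<Rightarrow>\<^sub>0 complex"

definition wf_a2 :: "a2 \<Rightarrow> bool" where
  "wf_a2 I = (\<forall>s\<in>Poly_Mapping.keys I. wf_share s)"

definition a2_cross :: "a2 \<Rightarrow> a2 \<Rightarrow> a2" where
  "a2_cross I H = (\<Sum>s\<in>Poly_Mapping.keys I. \<Sum>t\<in>Poly_Mapping.keys H.
      Poly_Mapping.single (cross_share s t) (Poly_Mapping.lookup I s * Poly_Mapping.lookup H t))"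

definition a2_form :: "a2 \<Rightarrow> a2 \<Rightarrow> complex poly" where
  "a2_form I H = (\<Sum>s\<in>Poly_Mapping.keys I. \<Sum>t\<in>Poly_Mapping.keys H.
      smult (Poly_Mapping.lookup I s * Poly_Mapping.lookup H t) (w_sl2 (join_share s t)))"

definition a2_sim :: "a2 \<Rightarrow> a2 \<Rightarrow> bool" where
  "a2_sim I I' = (\<forall>H. wf_share H \<longrightarrow>
      a2_form I (Poly_Mapping.single H 1) = a2_form I' (Poly_Mapping.single H 1))"

definition a2_scale :: "complex \<Rightarrow> a2 \<Rightarrow> a2" where
  "a2_scale a x = (\<Sum>s\<in>Poly_Mapping.keys x. Poly_Mapping.single s (a * Poly_Mapping.lookup x s))"

definition a2_one :: a2 where "a2_one = Poly_Mapping.single ([], []) 1"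
definition arch :: a2 where "arch = Poly_Mapping.single ([0, 0], []) 1"
definition bridge :: a2 where "bridge = Poly_Mapping.single ([0], [0]) 1"

definition a2_pow :: "a2 \<Rightarrow> nat \<Rightarrow> a2" where
  "a2_pow x n = (a2_cross x ^^ n) a2_one"

definition cpoly :: "complex poly \<Rightarrow> a2" where
  "cpoly q = (\<Sum>i\<le>degree q. a2_scale (coeff q i) (a2_pow arch i))"

definition pfac :: "nat \<Rightarrow> a2" where
  "pfac m = bridge - arch + a2_scale (of_nat (m * (m + 1)) / 2) a2_one"

definition pp :: "nat \<Rightarrow> a2" where
  "pp n = foldr (\<lambda>m acc. a2_cross (pfac m) acc) [0..<n] a2_one"

end

theory Submission
  imports Defs
begin

text \<open>
  Let a share act on square matrices by inserting a matrix between its two strands: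
  X is sent to the sum over colourings of (word of strand 1) X (word of strand 2). The cross
  product becomes composition, an arch acts by the Casimir value c, the bridge acts by
  Y X = x1 X x1 + x2 X x2 + x3 X x3, and Y = c - l(l+1)/2 on the matrices of spin l.

  Spanning: left and right multiplications are two commuting copies of sl2, and a share is a
  contraction of a word in their generators with an invariant tensor built from deltas and epsilons.
  Exchanging neighbouring letters changes the operator only by a shorter word of the same kind.
  After sorting, a delta splits off c or Y; and an epsilon has two legs on the same strand, so it
  reduces to shorter words by antisymmetry. Hence every share acts as a polynomial in c and Y. Applied
  to the identity matrix this also shows that the weight system takes values in C[c].

  Orthogonality: p_n kills the spins below n, hence all words of length less than n; one of the two
  orders of n and k is handled directly and the other by cyclicity of the trace.

  Independence: the pairing of p_k with the k-fold bridge is, up to a nonzero factor, the sum of the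
  squared norms of p_k applied to words of length k, and p_k does not kill the k-th power of J_+.
\<close>

text \<open>The numbers \<open>casimir_val d\<close> are pairwise distinct, so a polynomial in c is
  determined by its values in all irreducible representations. Identities between families therefore
  have coefficients in C[c] that are uniform in d, and the definite description in
  \<open>w_sl2\<close> has at most one solution. The constants c - l(l+1)/2 come from sum_a
  [x_a,[x_a,X]] = 2 c X - 2 Y X: Y is c minus half the adjoint Casimir operator. Matrices are never
  decomposed into spins. A filtration by word length takes over: Y minus its value at spin k sends
  combinations of words of length at most k to combinations of shorter words. The obstacle in
  spanning is that a commutator of two letters leaves a structure constant attached to the tensor,
  so the class of tensors must be closed under contraction with epsilon. It is, because two epsilons
  sharing a leg are a difference of products of deltas. The squared norms in the independence
  argument arise because the generators are Hermitian: the k-fold bridge pairs each word with its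
  adjoint.\<close>

text \<open>Families of d by d matrices, one for each dimension d: the ring in which identities in all
  irreducible representations are verified at once.\<close>

typedef mfam = "{M :: nat \<Rightarrow> nat \<Rightarrow> nat \<Rightarrow> complex. \<forall>d i k. \<not> (i < d \<and> k < d) \<longrightarrow> M d i k = 0}"
  morphisms entry Abs_mfam
  by (rule exI[of _ "\<lambda>_ _ _. 0"]) simp

setup_lifting type_definition_mfam

lemma entry_outside: "\<not> (i < d \<and> k < d) \<Longrightarrow> entry A d i k = 0"
  using entry[of A] by blast

lemma mfam_eqI: "(\<And>d i k. i < d \<Longrightarrow> k < d \<Longrightarrow> entry A d i k = entry B d i k) \<Longrightarrow> A = B"
  by (metis entry_outside entry_inject ext)

instantiation mfam :: ring_1
begin

lift_definition zero_mfam :: mfam is "\<lambda>_ _ _. 0" by simp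
lift_definition one_mfam :: mfam is "\<lambda>d. mid d" by (auto simp: mid_def)
lift_definition plus_mfam :: "mfam \<Rightarrow> mfam \<Rightarrow> mfam" is "\<lambda>A B d i k. A d i k + B d i k" by simp
lift_definition minus_mfam :: "mfam \<Rightarrow> mfam \<Rightarrow> mfam" is "\<lambda>A B d i k. A d i k - B d i k" by simp
lift_definition uminus_mfam :: "mfam \<Rightarrow> mfam" is "\<lambda>A d i k. - A d i k" by simp
lift_definition times_mfam :: "mfam \<Rightarrow> mfam \<Rightarrow> mfam" is "\<lambda>A B d. mmul d (A d) (B d)"
  by (auto simp: mmul_def intro!: sum.neutral)

instance
proof
  fix a b c :: mfam
  have "mmul d (mmul d A B) C = mmul d A (mmul d B C)" for d A B C
  proof (intro ext)
    fix i k
    have "mmul d (mmul d A B) C i k = (\<Sum>j<d. \<Sum>l<d. A i l * (B l j * C j k))"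
      by (simp add: mmul_def sum_distrib_right mult.assoc)
    also have "\<dots> = (\<Sum>l<d. \<Sum>j<d. A i l * (B l j * C j k))"
      by (rule sum.swap)
    also have "\<dots> = mmul d A (mmul d B C) i k"
      by (simp add: mmul_def sum_distrib_left)
    finally show "mmul d (mmul d A B) C i k = mmul d A (mmul d B C) i k" .
  qed
  then show "a * b * c = a * (b * c)" by transfer simp
  have "mmul d (mid d) A i k = (if i < d then A i k else 0)" for d A i k
  proof -
    have "mmul d (mid d) A i k = (\<Sum>j<d. if j = i then A i k else 0)"
      unfolding mmul_def by (rule sum.cong) (auto simp: mid_def)
    then show ?thesis by simp
  qed
  then show "1 * a = a" by transfer (auto simp: fun_eq_iff)
  have "mmul d A (mid d) i k = (if k < d then A i k else 0)" for d A i k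
  proof -
    have "mmul d A (mid d) i k = (\<Sum>j<d. if j = k then A i k else 0)"
      unfolding mmul_def by (rule sum.cong) (auto simp: mid_def)
    then show ?thesis by simp
  qed
  then show "a * 1 = a" by transfer (auto simp: fun_eq_iff)
  show "(a + b) * c = a * c + b * c" "a * (b + c) = a * b + a * c"
    by (transfer, simp add: mmul_def algebra_simps sum.distrib)+
  show "(0 :: mfam) \<noteq> 1"
  proof -
    \<comment> \<open>In dimension 0 the two families agree, so the entry is taken in dimension
      1.\<close>
    have "mid 1 0 0 = 1" by (simp add: mid_def)
    then show ?thesis by transfer (metis zero_neq_one)
  qed
qed (transfer; simp add: fun_eq_iff)+

end

text \<open>A polynomial acts through its value at the Casimir eigenvalue.\<close>

lift_definition smul :: "complex poly \<Rightarrow> mfam \<Rightarrow> mfam" (infixr "\<bullet>" 75)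
  is "\<lambda>p A d i k. poly p (casimir_val d) * A d i k" by simp

interpretation mf: module smul
  by standard (transfer; simp add: algebra_simps fun_eq_iff)+

lemma smul_mult_left [simp]: "(p \<bullet> A) * B = p \<bullet> (A * B)"
  by transfer (simp add: mmul_def sum_distrib_left mult.assoc)

lemma smul_mult_right [simp]: "A * (p \<bullet> B) = p \<bullet> (A * B)"
  by transfer (simp add: mmul_def sum_distrib_left mult.left_commute)

lemma entry_sum: "entry (sum f S) d i k = (\<Sum>s\<in>S. entry (f s) d i k)"
  by (induction S rule: infinite_finite_induct) (simp_all add: zero_mfam.rep_eq plus_mfam.rep_eq)

lemma casimir_val_eq_iff: "casimir_val d = casimir_val d' \<longleftrightarrow> d = d'"
proof
  assume "casimir_val d = casimir_val d'"
  then have "of_nat (d ^ 2) = (of_nat (d' ^ 2) :: complex)"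
    by (simp add: casimir_val_def)
  then show "d = d'" by (simp only: of_nat_eq_iff) simp
qed simp

text \<open>Infinitely many distinct Casimir values would be roots. The bound m serves independence,
  where the test matrices are nonzero only in dimensions above the word length; elsewhere it is
  0.\<close>

lemma poly_casimir_zero_imp:
  assumes "\<And>d. d > m \<Longrightarrow> poly p (casimir_val d) = 0"
  shows "p = 0"
proof (rule ccontr)
  assume "p \<noteq> 0"
  then have "finite {x. poly p x = 0}" by (rule poly_roots_finite)
  moreover have "casimir_val ` {m<..} \<subseteq> {x. poly p x = 0}" using assms by auto
  ultimately have "finite (casimir_val ` {m<..})" by (rule rev_finite_subset)
  then show False
    by (simp add: finite_image_iff inj_on_def casimir_val_eq_iff infinite_Ioi)
qed

text \<open>This lets equalities in C[c] be checked as equalities of scalar families, the passage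
  between \<open>a2_form\<close> and operators.\<close>

lemma smul_one_cancel: "p \<bullet> 1 = q \<bullet> 1 \<longleftrightarrow> p = q"
proof
  assume *: "p \<bullet> 1 = q \<bullet> 1"
  have "p - q = 0"
  proof (rule poly_casimir_zero_imp[of 0])
    fix d :: nat assume "d > 0"
    then show "poly (p - q) (casimir_val d) = 0"
      using arg_cong[OF *, of "\<lambda>A. entry A d 0 0"]
      by (simp add: smul.rep_eq one_mfam.rep_eq mid_def)
  qed
  then show "p = q" by simp
qed simp

subsection \<open>The generators of sl2\<close>

lift_definition fe :: mfam is jplus by (auto simp: jplus_def)
lift_definition ff :: mfam is jminus by (auto simp: jminus_def jplus_def)
lift_definition fh :: mfam is jz by (auto simp: jz_def)

abbreviation cst :: "complex \<Rightarrow> complex poly" where "cst z \<equiv> [:z:]"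

lemma jplus_square:
  assumes "Suc i < d"
  shows "jplus d i (Suc i) * jplus d i (Suc i) = of_nat (Suc i) * (of_nat d - of_nat (Suc i))"
proof -
  have "jplus d i (Suc i) * jplus d i (Suc i) = complex_of_real (real (Suc i) * real (d - Suc i))"
    using assms by (simp add: jplus_def del: of_nat_Suc flip: of_real_mult)
  then show ?thesis using assms by (simp add: of_nat_diff)
qed

lemma jplus_product:
  "mmul d (jplus d) (jminus d) i k =
    (if i = k \<and> Suc i < d then of_nat (Suc i) * (of_nat d - of_nat (Suc i)) else 0)"
proof -
  have "mmul d (jplus d) (jminus d) i k =
      (\<Sum>j<d. if j = Suc i then jplus d i (Suc i) * jplus d k (Suc i) else 0)"
    unfolding mmul_def jminus_def by (rule sum.cong) (auto simp: jplus_def)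
  also have "\<dots> = (if Suc i < d then jplus d i (Suc i) * jplus d k (Suc i) else 0)" by simp
  also have "\<dots> = (if i = k \<and> Suc i < d then jplus d i (Suc i) * jplus d i (Suc i) else 0)"
    by (auto simp: jplus_def)
  finally show ?thesis using jplus_square by (simp del: of_nat_Suc)
qed

lemma jminus_product:
  "mmul d (jminus d) (jplus d) i k = (if i = k \<and> i < d then of_nat i * (of_nat d - of_nat i) else 0)"
proof (cases i)
  case 0
  then show ?thesis by (auto simp: mmul_def jminus_def jplus_def intro!: sum.neutral)
next
  case (Suc i')
  have "mmul d (jminus d) (jplus d) i k =
      (\<Sum>j<d. if j = i' then jplus d i' (Suc i') * jplus d i' k else 0)"
    unfolding mmul_def jminus_def by (rule sum.cong) (auto simp: jplus_def Suc)
  also have "\<dots> = (if i' < d then jplus d i' (Suc i') * jplus d i' k else 0)" by simp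
  also have "\<dots> = (if i = k \<and> i < d then jplus d i' (Suc i') * jplus d i' (Suc i') else 0)"
    by (auto simp: jplus_def Suc)
  finally show ?thesis using jplus_square[of i' d] Suc by (auto simp del: of_nat_Suc)
qed

lemma jz_mult_left: "i < d \<Longrightarrow> mmul d (jz d) A i k = jz d i i * A i k"
proof -
  assume "i < d"
  moreover have "mmul d (jz d) A i k = (\<Sum>j<d. if j = i then jz d i i * A i k else 0)"
    unfolding mmul_def by (rule sum.cong) (auto simp: jz_def)
  ultimately show ?thesis by simp
qed

lemma jz_mult_right: "k < d \<Longrightarrow> mmul d A (jz d) i k = A i k * jz d k k"
proof -
  assume "k < d"
  moreover have "mmul d A (jz d) i k = (\<Sum>j<d. if j = k then A i k * jz d k k else 0)"
    unfolding mmul_def by (rule sum.cong) (auto simp: jz_def)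
  ultimately show ?thesis by simp
qed

lemma ef_commute: "fe * ff = ff * fe + cst 2 \<bullet> fh"
proof (rule mfam_eqI)
  fix d i k :: nat assume "i < d" "k < d"
  \<comment> \<open>In the last row \<open>jplus_product\<close> takes its zero branch, so that
    diagonal entry is computed apart.\<close>
  then consider "i \<noteq> k" | "i = k" "i + 1 < d" | "i = k" "d = i + 1" by linarith
  then show "entry (fe * ff) d i k = entry (ff * fe + cst 2 \<bullet> fh) d i k"
    by cases (simp_all add: times_mfam.rep_eq plus_mfam.rep_eq smul.rep_eq fe.rep_eq ff.rep_eq fh.rep_eq
      jplus_product jminus_product jz_def of_nat_diff field_simps)
qed

text \<open>The highest weight form of x_1^2 + x_2^2 + x_3^2: the first two squares add up to half
  of \<open>fe * ff + ff * fe\<close>, which is \<open>ff * fe + fh\<close>.\<close>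

lemma casimir_efh: "fh * fh + ff * fe + fh = [:0, 1:] \<bullet> 1"
proof (rule mfam_eqI)
  fix d i k :: nat assume "i < d" "k < d"
  then show "entry (fh * fh + ff * fe + fh) d i k = entry ([:0, 1:] \<bullet> 1) d i k"
    by (cases "i = k") (simp_all add: times_mfam.rep_eq plus_mfam.rep_eq smul.rep_eq fe.rep_eq ff.rep_eq fh.rep_eq
      one_mfam.rep_eq mid_def jminus_product jz_mult_left casimir_val_def jz_def of_nat_diff field_simps power2_eq_square)
qed

lemma he_commute: "fh * fe = fe * fh + fe"
proof (rule mfam_eqI)
  fix d i k :: nat assume "i < d" "k < d"
  moreover have "k = Suc i \<or> jplus d i k = 0" by (auto simp: jplus_def)
  ultimately show "entry (fh * fe) d i k = entry (fe * fh + fe) d i k"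
    by (auto simp: times_mfam.rep_eq plus_mfam.rep_eq fe.rep_eq fh.rep_eq jz_mult_left jz_mult_right
        jz_def field_simps)
qed

lemma fh_commute: "ff * fh = fh * ff + ff"
proof (rule mfam_eqI)
  fix d i k :: nat assume "i < d" "k < d"
  moreover have "i = Suc k \<or> jminus d i k = 0" by (auto simp: jminus_def jplus_def)
  ultimately show "entry (ff * fh) d i k = entry (fh * ff + ff) d i k"
    by (auto simp: times_mfam.rep_eq plus_mfam.rep_eq ff.rep_eq fh.rep_eq jz_mult_left jz_mult_right
        jz_def field_simps)
qed

datatype col = C1 | C2 | C3

lemma UNIV_col: "UNIV = {C1, C2, C3}"
  using col.exhaust by blast

instance col :: finite
  by standard (simp add: UNIV_col)

lemma sum_col: "(\<Sum>a\<in>UNIV. f a) = f C1 + f C2 + (f C3 :: 'a :: comm_monoid_add)"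
  by (simp add: UNIV_col add.assoc)

fun colnum :: "col \<Rightarrow> nat" where
  "colnum C1 = 1" | "colnum C2 = 2" | "colnum C3 = 3"

fun eps :: "col \<Rightarrow> col \<Rightarrow> col \<Rightarrow> complex" where
  "eps C1 C2 C3 = 1" | "eps C2 C3 C1 = 1" | "eps C3 C1 C2 = 1"
| "eps C1 C3 C2 = -1" | "eps C3 C2 C1 = -1" | "eps C2 C1 C3 = -1"
| "eps _ _ _ = 0"

definition delta :: "col \<Rightarrow> col \<Rightarrow> complex" where "delta a b = (if a = b then 1 else 0)"

fun xg :: "col \<Rightarrow> mfam" where
  "xg C1 = cst (1/2) \<bullet> (fe + ff)"
| "xg C2 = cst (- \<i>/2) \<bullet> (fe - ff)"
| "xg C3 = fh"

lemma entry_xg: "entry (xg a) d = xgen d (colnum a)"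
  by (cases a) (simp_all add: fun_eq_iff xgen_def smul.rep_eq plus_mfam.rep_eq minus_mfam.rep_eq
      fe.rep_eq ff.rep_eq fh.rep_eq field_simps)

lemmas entry_simps = zero_mfam.rep_eq plus_mfam.rep_eq minus_mfam.rep_eq uminus_mfam.rep_eq smul.rep_eq

lemma xg_commute: "xg a * xg b - xg b * xg a = (\<Sum>t\<in>UNIV. cst (\<i> * eps a b t) \<bullet> xg t)"
  by (cases a; cases b; rule mfam_eqI)
    (simp_all add: sum_col distrib_left distrib_right left_diff_distrib right_diff_distrib
      he_commute fh_commute ef_commute entry_simps)

lemma xg_casimir: "(\<Sum>a\<in>UNIV. xg a * xg a) = [:0, 1:] \<bullet> 1"
  unfolding casimir_efh[symmetric]
  by (rule mfam_eqI)
    (simp add: sum_col distrib_left distrib_right left_diff_distrib right_diff_distrib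
      ef_commute entry_simps)

subsection \<open>Invariant tensors\<close>

text \<open>A tensor is a function of the colours of its legs; the set S lists the names of the legs.\<close>

inductive tens :: "nat set \<Rightarrow> ((nat \<Rightarrow> col) \<Rightarrow> complex) \<Rightarrow> bool" where
  one: "tens {} (\<lambda>_. 1)"
| zero: "tens S (\<lambda>_. 0)"
| add: "tens S T \<Longrightarrow> tens S T' \<Longrightarrow> tens S (\<lambda>\<phi>. T \<phi> + T' \<phi>)"
| scale: "tens S T \<Longrightarrow> tens S (\<lambda>\<phi>. z * T \<phi>)"
| delta: "tens S T \<Longrightarrow> u \<notin> S \<Longrightarrow> v \<notin> S \<Longrightarrow> u \<noteq> v \<Longrightarrow>
    tens (insert u (insert v S)) (\<lambda>\<phi>. delta (\<phi> u) (\<phi> v) * T \<phi>)"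
| eps: "tens S T \<Longrightarrow> u \<notin> S \<Longrightarrow> v \<notin> S \<Longrightarrow> w \<notin> S \<Longrightarrow> u \<noteq> v \<Longrightarrow> u \<noteq> w \<Longrightarrow> v \<noteq> w \<Longrightarrow>
    tens (insert u (insert v (insert w S))) (\<lambda>\<phi>. eps (\<phi> u) (\<phi> v) (\<phi> w) * T \<phi>)"

lemma tens_local: "tens S T \<Longrightarrow> (\<And>u. u \<in> S \<Longrightarrow> \<phi> u = \<phi>' u) \<Longrightarrow> T \<phi> = T \<phi>'"
  by (induction rule: tens.induct) auto

lemma tens_upd: "tens S T \<Longrightarrow> u \<notin> S \<Longrightarrow> T (\<phi>(u := a)) = T \<phi>"
  by (rule tens_local) auto

lemma tens_rename: "tens S T \<Longrightarrow> inj_on f S \<Longrightarrow> tens (f ` S) (\<lambda>\<phi>. T (\<phi> \<circ> f))"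
proof (induction rule: tens.induct)
  case (delta S T u v)
  have "tens (insert (f u) (insert (f v) (f ` S)))
      (\<lambda>\<phi>. delta (\<phi> (f u)) (\<phi> (f v)) * T (\<phi> \<circ> f))"
    using delta.hyps delta.prems by (intro tens.delta delta.IH) (auto simp: inj_on_def)
  then show ?case by (simp add: comp_def)
next
  case (eps S T u v w)
  have "tens (insert (f u) (insert (f v) (insert (f w) (f ` S))))
      (\<lambda>\<phi>. eps (\<phi> (f u)) (\<phi> (f v)) (\<phi> (f w)) * T (\<phi> \<circ> f))"
    using eps.hyps eps.prems by (intro tens.eps eps.IH) (auto simp: inj_on_def)
  then show ?case by (simp add: comp_def)
qed (auto intro: tens.intros)

text \<open>Contracting a leg with a delta only renames it; this is the case of
  \<open>tens_contract\<close> in which one leg of a delta is joined to the rest.\<close>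

lemma tens_subst:
  assumes "tens S T" "q \<in> S" "v \<notin> S"
  shows "tens (insert v (S - {q})) (\<lambda>\<phi>. T (\<phi>(q := \<phi> v)))"
proof -
  let ?f = "id(q := v)"
  have "tens (?f ` S) (\<lambda>\<phi>. T (\<phi> \<circ> ?f))"
    using assms by (intro tens_rename) (auto simp: inj_on_def)
  moreover have "?f ` S = insert v (S - {q})" using assms by auto
  moreover have "\<phi> \<circ> ?f = \<phi>(q := \<phi> v)" for \<phi> :: "nat \<Rightarrow> col" by auto
  ultimately show ?thesis by simp
qed

lemma eps_cyclic: "eps x a y = eps a y x" "eps x y a = eps a x y"
  by (cases x; cases y; cases a; simp)+

lemma eps_antisym: "eps b a c = - eps a b c"
  by (cases a; cases b; cases c; simp)

lemma eps_repeat [simp]: "eps a a b = 0" "eps a b a = 0" "eps b a a = 0"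
  by (cases a; cases b; simp)+

text \<open>The identity that removes pairs of epsilons. Its right side has \<open>(-1) *\<close>
  and this order of arguments so that it matches the rules \<open>scale\<close> and
  \<open>delta\<close> of \<open>tens\<close>.\<close>

lemma eps_eps: "(\<Sum>a\<in>UNIV. eps a x y * eps a z w) = delta z x * delta w y + (-1) * (delta z y * delta w x)"
  unfolding sum_col by (cases x; cases y; cases z; cases w; simp add: delta_def)

lemma sum_delta: "(\<Sum>a\<in>UNIV. delta a x * f a) = f x" "(\<Sum>a\<in>UNIV. delta x a * f a) = f x"
  by (cases x; simp add: sum_col delta_def)+

lemma card_UNIV_col: "card (UNIV :: col set) = 3"
  by (simp add: UNIV_col)

lemma delta_refl [simp]: "delta a a = 1"
  by (simp add: delta_def)

text \<open>An epsilon is attached to leg q, with v and w as its free legs. It slides past every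
  factor not carrying q; a delta merely passes it on to its other leg, and with another epsilon
  \<open>eps_eps\<close> turns the pair into deltas.\<close>

lemma tens_eps_contract:
  "tens S T \<Longrightarrow> q \<in> S \<Longrightarrow> v \<notin> S \<Longrightarrow> w \<notin> S \<Longrightarrow> v \<noteq> w \<Longrightarrow>
    tens (insert v (insert w (S - {q}))) (\<lambda>\<phi>. \<Sum>a\<in>UNIV. eps a (\<phi> v) (\<phi> w) * T (\<phi>(q := a)))"
proof (induction rule: tens.induct)
  case (add S T T')
  from tens.add[OF add.IH(1)[OF add.prems] add.IH(2)[OF add.prems]]
  show ?case by (simp del: fun_upd_apply add: fun_upd_other fun_upd_same distrib_left sum.distrib)
next
  case (scale S T z)
  from tens.scale[OF scale.IH[OF scale.prems], of z]
  show ?case by (simp del: fun_upd_apply add: fun_upd_other fun_upd_same sum_distrib_left mult.left_commute)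
next
  case (delta S T u u')
  consider "q = u" | "q = u'" | "q \<in> S" "q \<noteq> u" "q \<noteq> u'" using delta by auto
  then show ?case
  proof cases
    case 1
    have "tens (insert u' (insert v (insert w S))) (\<lambda>\<phi>. eps (\<phi> u') (\<phi> v) (\<phi> w) * T \<phi>)"
      using delta by (intro tens.eps) auto
    moreover have "insert v (insert w (insert u (insert u' S) - {q})) = insert u' (insert v (insert w S))"
      using delta 1 by auto
    moreover have "(\<Sum>a\<in>UNIV. eps a (\<phi> v) (\<phi> w) * (delta ((\<phi>(q := a)) u) ((\<phi>(q := a)) u') * T (\<phi>(q := a))))
        = eps (\<phi> u') (\<phi> v) (\<phi> w) * T \<phi>" for \<phi>
      using delta 1 sum_delta(1)[of "\<phi> u'" "\<lambda>a. eps a (\<phi> v) (\<phi> w) * T \<phi>"]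
      by (simp add: tens_upd[OF delta.hyps(1)] mult.left_commute)
    ultimately show ?thesis by (simp del: fun_upd_apply add: fun_upd_other fun_upd_same)
  next
    case 2
    have "tens (insert u (insert v (insert w S))) (\<lambda>\<phi>. eps (\<phi> u) (\<phi> v) (\<phi> w) * T \<phi>)"
      using delta by (intro tens.eps) auto
    moreover have "insert v (insert w (insert u (insert u' S) - {q})) = insert u (insert v (insert w S))"
      using delta 2 by auto
    moreover have "(\<Sum>a\<in>UNIV. eps a (\<phi> v) (\<phi> w) * (delta ((\<phi>(q := a)) u) ((\<phi>(q := a)) u') * T (\<phi>(q := a))))
        = eps (\<phi> u) (\<phi> v) (\<phi> w) * T \<phi>" for \<phi>
      using delta 2 sum_delta(2)[of "\<phi> u" "\<lambda>a. eps a (\<phi> v) (\<phi> w) * T \<phi>"]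
      by (simp add: tens_upd[OF delta.hyps(1)] mult.left_commute)
    ultimately show ?thesis by (simp del: fun_upd_apply add: fun_upd_other fun_upd_same)
  next
    case 3
    have "tens (insert u (insert u' (insert v (insert w (S - {q})))))
       (\<lambda>\<phi>. delta (\<phi> u) (\<phi> u') * (\<Sum>a\<in>UNIV. eps a (\<phi> v) (\<phi> w) * T (\<phi>(q := a))))"
      using delta 3 by (intro tens.delta delta.IH) auto
    moreover have "insert v (insert w (insert u (insert u' S) - {q}))
        = insert u (insert u' (insert v (insert w (S - {q}))))"
      using delta 3 by auto
    ultimately show ?thesis using 3 by (simp del: fun_upd_apply add: fun_upd_other fun_upd_same sum_distrib_left mult.left_commute)
  qed
next
  case (eps S T u1 u2 u3)
  \<comment> \<open>Here x and y are the legs left on the old epsilon, in the cyclic order that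
    starts after q, so the three positions of q need no sign.\<close>
  have *: "tens (insert x (insert y (insert v (insert w S))))
      (\<lambda>\<phi>. \<Sum>a\<in>UNIV. eps a (\<phi> v) (\<phi> w) * (eps a (\<phi> x) (\<phi> y) * T \<phi>))"
    if "x \<notin> S" "y \<notin> S" "x \<noteq> y" "x \<notin> {v, w}" "y \<notin> {v, w}" for x y
  proof -
    have d1: "tens (insert x (insert v (insert y (insert w S))))
       (\<lambda>\<phi>. delta (\<phi> x) (\<phi> v) * (delta (\<phi> y) (\<phi> w) * T \<phi>))"
      using that eps by (intro tens.delta) auto
    have d2: "tens (insert x (insert w (insert y (insert v S))))
       (\<lambda>\<phi>. (-1) * (delta (\<phi> x) (\<phi> w) * (delta (\<phi> y) (\<phi> v) * T \<phi>)))"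
      using that eps by (intro tens.scale tens.delta) auto
    have e: "insert x (insert v (insert y (insert w S))) = insert x (insert y (insert v (insert w S)))"
      "insert x (insert w (insert y (insert v S))) = insert x (insert y (insert v (insert w S)))" by auto
    note tens.add[OF d1[unfolded e(1)] d2[unfolded e(2)]]
    moreover have "(\<Sum>a\<in>UNIV. eps a (\<phi> v) (\<phi> w) * (eps a (\<phi> x) (\<phi> y) * T \<phi>)) =
       delta (\<phi> x) (\<phi> v) * (delta (\<phi> y) (\<phi> w) * T \<phi>)
        + (-1) * (delta (\<phi> x) (\<phi> w) * (delta (\<phi> y) (\<phi> v) * T \<phi>))" for \<phi>
    proof -
      have "(\<Sum>a\<in>UNIV. eps a (\<phi> v) (\<phi> w) * (eps a (\<phi> x) (\<phi> y) * T \<phi>)) =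
          (\<Sum>a\<in>UNIV. eps a (\<phi> v) (\<phi> w) * eps a (\<phi> x) (\<phi> y)) * T \<phi>"
        by (simp add: sum_distrib_right mult.assoc)
      then show ?thesis unfolding eps_eps by (simp add: algebra_simps)
    qed
    ultimately show ?thesis by (simp del: fun_upd_apply add: fun_upd_other fun_upd_same)
  qed
  have n: "u1 \<notin> {v, w}" "u2 \<notin> {v, w}" "u3 \<notin> {v, w}" using eps.prems by auto
  consider "q = u1" | "q = u2" | "q = u3" | "q \<in> S" "q \<noteq> u1" "q \<noteq> u2" "q \<noteq> u3"
    using eps by auto
  then show ?case
  proof cases
    case 1
    then have "insert v (insert w (insert u1 (insert u2 (insert u3 S)) - {q})) =
      insert u2 (insert u3 (insert v (insert w S)))" using eps by auto
    moreover have "T (\<phi>(u1 := a)) = T \<phi>" for \<phi> a using eps tens_upd by auto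
    ultimately show ?thesis using *[OF eps.hyps(3,4,7) n(2,3)] eps.hyps 1 by (simp del: fun_upd_apply add: fun_upd_other fun_upd_same)
  next
    case 2
    then have "insert v (insert w (insert u1 (insert u2 (insert u3 S)) - {q})) =
      insert u3 (insert u1 (insert v (insert w S)))" using eps by auto
    moreover have "T (\<phi>(u2 := a)) = T \<phi>" for \<phi> a using eps tens_upd by auto
    ultimately show ?thesis using *[OF eps.hyps(4,2) eps.hyps(6)[symmetric] n(3,1)] eps.hyps 2 by (simp del: fun_upd_apply add: fun_upd_other fun_upd_same eps_cyclic(1))
  next
    case 3
    then have "insert v (insert w (insert u1 (insert u2 (insert u3 S)) - {q})) =
      insert u1 (insert u2 (insert v (insert w S)))" using eps by auto
    moreover have "T (\<phi>(u3 := a)) = T \<phi>" for \<phi> a using eps tens_upd by auto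
    ultimately show ?thesis using *[OF eps.hyps(2,3,5) n(1,2)] eps.hyps 3 by (simp del: fun_upd_apply add: fun_upd_other fun_upd_same eps_cyclic(2)[of "_ u1"])
  next
    case 4
    have "tens (insert u1 (insert u2 (insert u3 (insert v (insert w (S - {q}))))))
       (\<lambda>\<phi>. eps (\<phi> u1) (\<phi> u2) (\<phi> u3) * (\<Sum>a\<in>UNIV. eps a (\<phi> v) (\<phi> w) * T (\<phi>(q := a))))"
      using eps.hyps eps.prems 4 by (intro tens.eps eps.IH) auto
    moreover have "insert v (insert w (insert u1 (insert u2 (insert u3 S)) - {q}))
        = insert u1 (insert u2 (insert u3 (insert v (insert w (S - {q})))))"
      using eps 4 by auto
    ultimately show ?thesis using 4 by (simp del: fun_upd_apply add: fun_upd_other fun_upd_same sum_distrib_left mult.left_commute)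
  qed
qed (auto intro: tens.intros)

text \<open>Joining two legs: a delta with both legs joined is a loop, a delta with one leg joined
  renames, an epsilon with one leg joined is \<open>tens_eps_contract\<close>, and one with two legs
  joined vanishes.\<close>

lemma tens_contract:
  "tens S T \<Longrightarrow> p \<in> S \<Longrightarrow> q \<in> S \<Longrightarrow> p \<noteq> q \<Longrightarrow>
    tens (S - {p, q}) (\<lambda>\<phi>. \<Sum>a\<in>UNIV. T (\<phi>(p := a, q := a)))"
proof (induction arbitrary: p q rule: tens.induct)
  case (add S T T')
  from tens.add[OF add.IH(1)[OF add.prems] add.IH(2)[OF add.prems]]
  show ?case by (simp del: fun_upd_apply add: fun_upd_other fun_upd_same sum.distrib)
next
  case (scale S T z)
  from tens.scale[OF scale.IH[OF scale.prems], of z]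
  show ?case by (simp del: fun_upd_apply add: fun_upd_other fun_upd_same sum_distrib_left)
next
  case (delta S T u v)
  have *: "tens (insert u (insert v S) - {p, q})
      (\<lambda>\<phi>. \<Sum>a\<in>UNIV. delta ((\<phi>(p := a, q := a)) u) ((\<phi>(p := a, q := a)) v) * T (\<phi>(p := a, q := a)))"
    if "p \<in> {u, v}" "q \<in> S" for p q
  proof -
    have "q \<noteq> u" "q \<noteq> v" using that delta.hyps by auto
    define r where "r = (if p = u then v else u)"
    then have r: "r \<notin> S" "r \<noteq> p" "{p, r} = {u, v}"
      using that(1) delta.hyps by auto
    have "insert u (insert v S) - {p, q} = insert r (S - {q})" using r that delta.hyps by auto
    moreover have "T (\<phi>(p := a, q := a)) = T (\<phi>(q := a))" for \<phi> a
      using that delta.hyps by (intro tens_local[OF delta.hyps(1)]) auto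
    moreover have "(\<Sum>a\<in>UNIV. delta ((\<phi>(p := a, q := a)) u) ((\<phi>(p := a, q := a)) v) * T (\<phi>(q := a)))
        = T (\<phi>(q := \<phi> r))" for \<phi>
      using r \<open>q \<noteq> u\<close> \<open>q \<noteq> v\<close> sum_delta[of "\<phi> r" "\<lambda>a. T (\<phi>(q := a))"] by (auto simp: doubleton_eq_iff)
    ultimately show ?thesis using tens_subst[OF delta.hyps(1) that(2) r(1)] by (simp del: fun_upd_apply add: fun_upd_other fun_upd_same)
  qed
  consider "p \<in> {u, v}" "q \<in> S" | "q \<in> {u, v}" "p \<in> S" | "{p, q} = {u, v}" | "p \<in> S" "q \<in> S"
    using delta.prems by auto
  then show ?case
  proof cases
    case 1
    then show ?thesis by (rule *)
  next
    case 2
    then have "insert u (insert v S) - {q, p} = insert u (insert v S) - {p, q}"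
      "\<phi>(q := a, p := a) = \<phi>(p := a, q := a)" for \<phi> and a :: col using delta.prems by auto
    then show ?thesis using *[OF 2] by (simp del: fun_upd_apply add: fun_upd_other fun_upd_same)
  next
    case 3
    have "T (\<phi>(p := a, q := a)) = T \<phi>" for \<phi> a
      using 3 delta.hyps by (intro tens_local[OF delta.hyps(1)]) auto
    moreover have "(\<phi>(p := a, q := a)) u = a" "(\<phi>(p := a, q := a)) v = a" for \<phi> and a :: col
      using 3 by (auto simp: doubleton_eq_iff)
    moreover have "insert u (insert v S) - {p, q} = S" using 3 delta.hyps by auto
    \<comment> \<open>The loop counts the colours, hence the factor 3.\<close>
    ultimately show ?thesis using tens.scale[OF delta.hyps(1), of 3]
      by (simp del: fun_upd_apply add: card_UNIV_col)
  next
    case 4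
    have "tens (insert u (insert v (S - {p, q})))
        (\<lambda>\<phi>. delta (\<phi> u) (\<phi> v) * (\<Sum>a\<in>UNIV. T (\<phi>(p := a, q := a))))"
      using delta.hyps delta.prems 4 by (intro tens.delta delta.IH) auto
    moreover have "insert u (insert v S) - {p, q} = insert u (insert v (S - {p, q}))"
      "u \<noteq> p" "u \<noteq> q" "v \<noteq> p" "v \<noteq> q" using delta.hyps 4 by auto
    ultimately show ?thesis by (simp del: fun_upd_apply add: fun_upd_other fun_upd_same sum_distrib_left)
  qed
next
  case (eps S T u v w)
  let ?U = "insert u (insert v (insert w S))"
  have *: "tens (?U - {p, q}) (\<lambda>\<phi>. \<Sum>a\<in>UNIV. eps ((\<phi>(p := a, q := a)) u) ((\<phi>(p := a, q := a)) v)
      ((\<phi>(p := a, q := a)) w) * T (\<phi>(p := a, q := a)))"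
    if "p \<in> {u, v, w}" "q \<in> S" for p q
  proof -
    \<comment> \<open>The two remaining legs, chosen so that (p, r, s) is a cyclic rotation of (u,
      v, w).\<close>
    define r s where "r = (if p = u then v else if p = v then w else u)"
      and "s = (if p = u then w else if p = v then u else v)"
    then have r: "r \<notin> S" "s \<notin> S" "r \<noteq> s" "r \<noteq> p" "s \<noteq> p"
      "(p, r, s) \<in> {(u, v, w), (v, w, u), (w, u, v)}" using that(1) eps.hyps by auto
    have "?U - {p, q} = insert r (insert s (S - {q}))" using r that eps.hyps by auto
    moreover have "T (\<phi>(p := a, q := a)) = T (\<phi>(q := a))" for \<phi> a
      using that eps.hyps by (intro tens_local[OF eps.hyps(1)]) auto
    moreover have "eps ((\<phi>(p := a, q := a)) u) ((\<phi>(p := a, q := a)) v) ((\<phi>(p := a, q := a)) w)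
        = eps a (\<phi> r) (\<phi> s)" for \<phi> a
    proof -
      have "eps x a y = eps a y x" "eps x y a = eps a x y" for x y by (fact eps_cyclic)+
      then show ?thesis using r that eps.hyps by auto
    qed
    ultimately show ?thesis using tens_eps_contract[OF eps.hyps(1) that(2) r(1-3)] by (simp del: fun_upd_apply add: fun_upd_other fun_upd_same)
  qed
  consider "p \<in> {u, v, w}" "q \<in> S" | "q \<in> {u, v, w}" "p \<in> S" | "p \<in> {u, v, w}" "q \<in> {u, v, w}" | "p \<in> S" "q \<in> S"
    using eps.prems by auto
  then show ?case
  proof cases
    case 1
    then show ?thesis by (rule *)
  next
    case 2
    then have "?U - {q, p} = ?U - {p, q}"
      "\<phi>(q := a, p := a) = \<phi>(p := a, q := a)" for \<phi> and a :: col using eps.prems by auto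
    then show ?thesis using *[OF 2] by (simp del: fun_upd_apply add: fun_upd_other fun_upd_same)
  next
    case 3
    then have "eps ((\<phi>(p := a, q := a)) u) ((\<phi>(p := a, q := a)) v) ((\<phi>(p := a, q := a)) w) = 0" for \<phi> a
      using eps.prems by auto
    then show ?thesis by (simp del: fun_upd_apply add: fun_upd_other fun_upd_same tens.zero)
  next
    case 4
    have "tens (insert u (insert v (insert w (S - {p, q}))))
        (\<lambda>\<phi>. eps (\<phi> u) (\<phi> v) (\<phi> w) * (\<Sum>a\<in>UNIV. T (\<phi>(p := a, q := a))))"
      using eps.hyps eps.prems 4 by (intro tens.eps eps.IH) auto
    moreover have "?U - {p, q} = insert u (insert v (insert w (S - {p, q})))"
      "u \<noteq> p" "u \<noteq> q" "v \<noteq> p" "v \<noteq> q" "w \<noteq> p" "w \<noteq> q" using eps.hyps 4 by auto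
    ultimately show ?thesis by (simp del: fun_upd_apply add: fun_upd_other fun_upd_same sum_distrib_left)
  qed
qed (auto intro: tens.intros)

text \<open>The tensor left behind when the letters u and v are replaced by their commutator t.
  Finiteness of S provides an auxiliary leg; rule \<open>zero\<close> by itself allows any
  S.\<close>

lemma tens_commutator:
  assumes "tens S T" "u \<in> S" "v \<in> S" "u \<noteq> v" "t \<notin> S" "finite S"
  shows "tens (insert t (S - {u, v}))
    (\<lambda>\<phi>. \<Sum>a\<in>UNIV. \<Sum>b\<in>UNIV. eps a b (\<phi> t) * T (\<phi>(u := a, v := b)))"
proof -
  \<comment> \<open>The epsilon is first attached to u with a fresh leg v', because
    \<open>tens_eps_contract\<close> wants free legs outside S; then v' is joined to v.\<close>
  obtain v' where v': "v' \<notin> insert t S"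
    using assms(6) ex_new_if_finite[of "insert t S"] by auto
  have 1: "tens (insert v' (insert t (S - {u}))) (\<lambda>\<phi>. \<Sum>a\<in>UNIV. eps a (\<phi> v') (\<phi> t) * T (\<phi>(u := a)))"
    using assms v' by (intro tens_eps_contract) auto
  have "tens (insert v' (insert t (S - {u})) - {v', v}) (\<lambda>\<phi>. \<Sum>b\<in>UNIV. \<Sum>a\<in>UNIV.
      eps a ((\<phi>(v' := b, v := b)) v') ((\<phi>(v' := b, v := b)) t) * T (\<phi>(v' := b, v := b, u := a)))"
    using assms v' by (intro tens_contract[OF 1]) auto
  moreover have "insert v' (insert t (S - {u})) - {v', v} = insert t (S - {u, v})"
    using assms v' by auto
  moreover have "T (\<phi>(v' := b, v := b, u := a)) = T (\<phi>(u := a, v := b))" for \<phi> a b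
    using assms v' by (intro tens_local[OF assms(1)]) auto
  moreover have "(\<phi>(v' := b, v := b)) v' = b" "(\<phi>(v' := b, v := b)) t = \<phi> t" for \<phi> and b :: col
    using assms v' by auto
  ultimately show ?thesis by (subst sum.swap) simp
qed

subsection \<open>Operators generated by the bridge\<close>

definition yop :: "mfam \<Rightarrow> mfam" where "yop X = (\<Sum>a\<in>UNIV. xg a * X * xg a)"

text \<open>The eigenvalue of \<open>yop\<close> on spin n, so that \<open>pfac n\<close> acts as
  \<open>yop\<close> minus \<open>eig n\<close>.\<close>

definition eig :: "nat \<Rightarrow> complex poly" where "eig n = [:- (of_nat (n * (n + 1)) / 2), 1:]"

fun pop :: "nat \<Rightarrow> mfam \<Rightarrow> mfam" where
  "pop 0 X = X"
| "pop (Suc n) X = yop (pop n X) - eig n \<bullet> pop n X"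

lemma yop_add: "yop (X + Z) = yop X + yop Z"
  by (simp add: yop_def distrib_left distrib_right sum.distrib)

lemma yop_diff: "yop (X - Z) = yop X - yop Z"
  by (simp add: yop_def left_diff_distrib right_diff_distrib sum_subtractf)

lemma yop_smul: "yop (p \<bullet> X) = p \<bullet> yop X"
  by (simp add: yop_def mf.scale_sum_right)

lemma yop_zero [simp]: "yop 0 = 0"
  by (simp add: yop_def)

lemma yop_sum: "yop (\<Sum>s\<in>S. f s) = (\<Sum>s\<in>S. yop (f s))"
  by (induction S rule: infinite_finite_induct) (simp_all add: yop_add)

lemma pop_add: "pop n (X + Z) = pop n X + pop n Z"
  by (induction n) (simp_all add: yop_add mf.scale_right_distrib algebra_simps)

lemma pop_smul: "pop n (p \<bullet> X) = p \<bullet> pop n X"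
  by (induction n) (simp_all add: yop_smul mf.scale_right_diff_distrib mult.commute)

lemma pop_zero [simp]: "pop n 0 = 0"
  by (induction n) simp_all

lemma pop_yop: "pop n (yop X) = yop (pop n X)"
  by (induction n) (simp_all add: yop_diff yop_smul)

text \<open>The C[c]-span of the operators \<open>pop n\<close>, hence all polynomials in c and Y,
  since \<open>pop n\<close> is monic of degree n in Y. Membership concerns the whole operator, so
  the coefficients depend neither on X nor on the dimension.\<close>

inductive good :: "(mfam \<Rightarrow> mfam) \<Rightarrow> bool" where
  zero: "good (\<lambda>X. 0)"
| step: "good Z \<Longrightarrow> good (\<lambda>X. Z X + q \<bullet> pop n X)"

lemma good_add: "good Z' \<Longrightarrow> good Z \<Longrightarrow> good (\<lambda>X. Z X + Z' X)"
proof (induction rule: good.induct)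
  case (step Z' q n)
  from good.step[OF step.IH[OF step.prems], of q n] show ?case by (simp add: add.assoc)
qed simp

lemma good_smul: "good Z \<Longrightarrow> good (\<lambda>X. p \<bullet> Z X)"
proof (induction rule: good.induct)
  case (step Z q n)
  from good.step[OF step.IH, of "p * q" n] show ?case by (simp add: mf.scale_right_distrib)
qed (simp add: good.zero)

lemma good_diff: "good Z \<Longrightarrow> good Z' \<Longrightarrow> good (\<lambda>X. Z X - Z' X)"
  using good_add[OF good_smul[of Z' "- 1"], of Z] by simp

lemma good_id: "good (\<lambda>X. X)"
  using good.step[OF good.zero, of 1 0] by simp

text \<open>The recursion of \<open>pop\<close> read backwards: Y p_n = p_(n+1) +
  \<open>eig n\<close> p_n.\<close>

lemma good_yop: "good Z \<Longrightarrow> good (\<lambda>X. yop (Z X))"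
proof (induction rule: good.induct)
  case (step Z q n)
  have "yop (Z X + q \<bullet> pop n X) = yop (Z X) + q \<bullet> pop (Suc n) X + (q * eig n) \<bullet> pop n X" for X
    by (simp add: yop_add yop_smul mf.scale_right_diff_distrib flip: mf.scale_scale)
  then show ?case using good.step[OF good.step[OF step.IH, of q "Suc n"], of "q * eig n" n]
    by (simp del: pop.simps)
qed (simp add: good.zero)

lemma good_sum: "(\<And>s. s \<in> S \<Longrightarrow> good (Z s)) \<Longrightarrow> good (\<lambda>X. \<Sum>s\<in>S. Z s X)"
  by (induction S rule: infinite_finite_induct) (simp_all add: good.zero good_add add.commute)

lemma good_expansion: "good Z \<Longrightarrow> \<exists>N q. \<forall>X. Z X = (\<Sum>n<N. q n \<bullet> pop n X)"
proof (induction rule: good.induct)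
  case zero
  show ?case by (rule exI[of _ 0]) simp
next
  case (step Z q' m)
  then obtain N q where Z: "\<And>X. Z X = (\<Sum>n<N. q n \<bullet> pop n X)" by blast
  define M where "M = max N (Suc m)"
  define r where "r n = (if n < N then q n else 0) + (if n = m then q' else 0)" for n
  have "Z X + q' \<bullet> pop m X = (\<Sum>n<M. r n \<bullet> pop n X)" for X
  proof -
    have "(\<Sum>n<M. r n \<bullet> pop n X) = (\<Sum>n<M. if n < N then q n \<bullet> pop n X else 0)
        + (\<Sum>n<M. if n = m then q' \<bullet> pop n X else 0)"
      unfolding sum.distrib[symmetric]
      by (rule sum.cong) (auto simp: r_def mf.scale_left_distrib)
    also have "(\<Sum>n<M. if n = m then q' \<bullet> pop n X else 0) = q' \<bullet> pop m X"
      by (simp add: M_def less_max_iff_disj)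
    also have "(\<Sum>n<M. if n < N then q n \<bullet> pop n X else 0) = Z X"
      unfolding Z by (rule sum.mono_neutral_cong_right) (auto simp: M_def)
    finally show ?thesis by simp
  qed
  then show ?case by blast
qed

subsection \<open>Contracted words\<close>

text \<open>A letter is marked True if it multiplies from the right.\<close>

fun actw :: "(nat \<Rightarrow> col) \<Rightarrow> (bool \<times> nat) list \<Rightarrow> mfam \<Rightarrow> mfam" where
  "actw \<phi> [] X = X"
| "actw \<phi> ((b, l) # w) X = (if b then actw \<phi> w X * xg (\<phi> l) else xg (\<phi> l) * actw \<phi> w X)"

lemma actw_append: "actw \<phi> (w @ w') X = actw \<phi> w (actw \<phi> w' X)"
  by (induction \<phi> w X rule: actw.induct) auto

lemma actw_upd [simp]: "u \<notin> snd ` set w \<Longrightarrow> actw (\<phi>(u := a)) w X = actw \<phi> w X"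
  by (induction \<phi> w X rule: actw.induct) auto

lemma actw_diff: "actw \<phi> w (X - Z) = actw \<phi> w X - actw \<phi> w Z"
  by (induction w) (auto simp: left_diff_distrib right_diff_distrib)

lemma actw_zero [simp]: "actw \<phi> w 0 = 0"
  by (induction w) auto

lemma actw_add: "actw \<phi> w (X + Z) = actw \<phi> w X + actw \<phi> w Z"
  by (induction w) (auto simp: distrib_left distrib_right)

lemma actw_sum: "actw \<phi> w (\<Sum>s\<in>S. f s) = (\<Sum>s\<in>S. actw \<phi> w (f s))"
  by (induction S rule: infinite_finite_induct) (simp_all add: actw_add)

lemma actw_smul: "actw \<phi> w (p \<bullet> X) = p \<bullet> actw \<phi> w X"
  by (induction w) auto

definition cols :: "nat set \<Rightarrow> (nat \<Rightarrow> col) set" where "cols S = S \<rightarrow>\<^sub>E UNIV"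

lemma cols_empty [simp]: "cols {} = {\<lambda>_. undefined}"
  by (simp add: cols_def)

lemma sum_cols_insert:
  assumes "u \<notin> S"
  shows "(\<Sum>\<phi>\<in>cols (insert u S). F \<phi>) = (\<Sum>\<phi>\<in>cols S. \<Sum>a\<in>UNIV. F (\<phi>(u := a)))"
proof -
  have "inj_on (\<lambda>(a, \<phi>). \<phi>(u := a)) (UNIV \<times> cols S)"
    using inj_combinator[OF assms, of "\<lambda>_. UNIV"] by (simp add: cols_def)
  then have "(\<Sum>\<phi>\<in>cols (insert u S). F \<phi>) = (\<Sum>(a, \<phi>)\<in>UNIV \<times> cols S. F (\<phi>(u := a)))"
    unfolding cols_def PiE_insert_eq by (subst sum.reindex) (auto simp: case_prod_unfold)
  also have "\<dots> = (\<Sum>a\<in>UNIV. \<Sum>\<phi>\<in>cols S. F (\<phi>(u := a)))"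
    by (simp add: sum.cartesian_product)
  finally show ?thesis by (subst sum.swap)
qed

text \<open>The labels of the word are the names of the legs of T. A label may also occur twice,
  which is how chords are read when T = 1.\<close>

definition Zop :: "((nat \<Rightarrow> col) \<Rightarrow> complex) \<Rightarrow> (bool \<times> nat) list \<Rightarrow> mfam \<Rightarrow> mfam" where
  "Zop T w X = (\<Sum>\<phi>\<in>cols (snd ` set w). cst (T \<phi>) \<bullet> actw \<phi> w X)"

lemma cst_add: "cst (x + y) \<bullet> X = cst x \<bullet> X + cst y \<bullet> X"
  by (simp flip: mf.scale_left_distrib)

lemma cst_sum: "cst (\<Sum>s\<in>S. f s) \<bullet> X = (\<Sum>s\<in>S. cst (f s) \<bullet> X)"
  by (induction S rule: infinite_finite_induct) (simp_all add: cst_add)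

lemma cst_one [simp]: "cst 1 \<bullet> X = X"
  by (simp flip: one_pCons)

lemma cst_mult: "cst (x * y) \<bullet> X = cst x \<bullet> cst y \<bullet> X"
  by (simp add: mult.commute)

lemma Zop_add: "Zop (\<lambda>\<phi>. T \<phi> + T' \<phi>) w X = Zop T w X + Zop T' w X"
  by (simp add: Zop_def cst_add sum.distrib)

lemma Zop_scale: "Zop (\<lambda>\<phi>. z * T \<phi>) w X = cst z \<bullet> Zop T w X"
  by (simp add: Zop_def mf.scale_sum_right mult.commute)

text \<open>Left and right multiplications commute by associativity, so no correction term
  arises.\<close>

lemma Zop_swap_different:
  "Zop T (w1 @ (b, u) # (\<not> b, v) # w2) X = Zop T (w1 @ (\<not> b, v) # (b, u) # w2) X"
  unfolding Zop_def by (cases b) (auto simp: actw_append mult.assoc insert_commute)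

lemma sum_rotate3: "(\<Sum>x\<in>A. \<Sum>y\<in>B. \<Sum>z\<in>C. G x y z) = (\<Sum>z\<in>C. \<Sum>y\<in>B. \<Sum>x\<in>A. G x y z)"
proof -
  have "(\<Sum>x\<in>A. \<Sum>y\<in>B. \<Sum>z\<in>C. G x y z) = (\<Sum>y\<in>B. \<Sum>x\<in>A. \<Sum>z\<in>C. G x y z)"
    by (rule sum.swap)
  also have "\<dots> = (\<Sum>y\<in>B. \<Sum>z\<in>C. \<Sum>x\<in>A. G x y z)"
    by (rule sum.cong[OF refl], rule sum.swap)
  also have "\<dots> = (\<Sum>z\<in>C. \<Sum>y\<in>B. \<Sum>x\<in>A. G x y z)"
    by (rule sum.swap)
  finally show ?thesis .
qed

text \<open>The commutator relation with its structure constant moved into the tensor; one letter t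
  replaces u and v. The sign changes on the right strand because right multiplication reverses
  products.\<close>

lemma Zop_swap_same:
  assumes "tens S T" "S = snd ` set (w1 @ (b, u) # (b, v) # w2)"
    and "distinct (map snd (w1 @ (b, u) # (b, v) # w2))" "t \<notin> S"
  shows "Zop T (w1 @ (b, u) # (b, v) # w2) X - Zop T (w1 @ (b, v) # (b, u) # w2) X =
    cst (if b then - \<i> else \<i>) \<bullet>
      Zop (\<lambda>\<phi>. \<Sum>a\<in>UNIV. \<Sum>c\<in>UNIV. eps a c (\<phi> t) * T (\<phi>(u := a, v := c))) (w1 @ (b, t) # w2) X"
proof -
  define S0 where "S0 = snd ` set (w1 @ w2)"
  have S: "S = insert u (insert v S0)" and uv: "u \<notin> S0" "v \<notin> S0" "u \<noteq> v"
    using assms(2,3) by (auto simp: S0_def)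
  have t: "t \<notin> S0" "t \<noteq> u" "t \<noteq> v" using assms(4) S by auto
  have notin: "u \<notin> snd ` set w1" "u \<notin> snd ` set w2" "v \<notin> snd ` set w1" "v \<notin> snd ` set w2"
    "t \<notin> snd ` set w1" "t \<notin> snd ` set w2"
    using uv t by (auto simp: S0_def)
  define V where "V \<phi> = actw \<phi> w2 X" for \<phi>
  define M where "M \<phi> c = actw \<phi> w1 (if b then V \<phi> * xg c else xg c * V \<phi>)" for \<phi> c
  let ?s = "if b then - \<i> else \<i>"
  have inner: "actw \<psi> (w1 @ (b, u) # (b, v) # w2) X - actw \<psi> (w1 @ (b, v) # (b, u) # w2) X
      = (\<Sum>c\<in>UNIV. cst (?s * eps a a' c) \<bullet> M \<phi> c)" if "\<psi> = \<phi>(v := a', u := a)" for \<phi> \<psi> a a'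
  proof -
    have "actw \<psi> (w1 @ (b, u) # (b, v) # w2) X - actw \<psi> (w1 @ (b, v) # (b, u) # w2) X
        = actw \<phi> w1 (if b then V \<phi> * (xg a' * xg a - xg a * xg a') else (xg a * xg a' - xg a' * xg a) * V \<phi>)"
      using notin uv that
      by (simp add: actw_append V_def left_diff_distrib right_diff_distrib mult.assoc flip: actw_diff)
    also have "\<dots> = actw \<phi> w1 (\<Sum>c\<in>UNIV. cst (?s * eps a a' c) \<bullet> (if b then V \<phi> * xg c else xg c * V \<phi>))"
      by (simp add: xg_commute eps_antisym[of a' a] sum_distrib_left sum_distrib_right)
    finally show ?thesis by (simp add: actw_sum actw_smul M_def)
  qed
  have sets: "snd ` set (w1 @ (b, u) # (b, v) # w2) = insert u (insert v S0)"
    "snd ` set (w1 @ (b, v) # (b, u) # w2) = insert u (insert v S0)"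
    "snd ` set (w1 @ (b, t) # w2) = insert t S0" by (auto simp: S0_def)
  have "Zop T (w1 @ (b, u) # (b, v) # w2) X - Zop T (w1 @ (b, v) # (b, u) # w2) X
     = (\<Sum>\<phi>\<in>cols S0. \<Sum>a'\<in>UNIV. \<Sum>a\<in>UNIV. cst (T (\<phi>(v := a', u := a))) \<bullet> (\<Sum>c\<in>UNIV. cst (?s * eps a a' c) \<bullet> M \<phi> c))"
    unfolding Zop_def sets sum_subtractf[symmetric] mf.scale_right_diff_distrib[symmetric]
    using uv by (simp add: sum_cols_insert inner del: fun_upd_apply)
  also have "\<dots> = (\<Sum>\<phi>\<in>cols S0. \<Sum>c\<in>UNIV. \<Sum>a\<in>UNIV. \<Sum>a'\<in>UNIV.
      cst (?s * (eps a a' c * T (\<phi>(v := a', u := a)))) \<bullet> M \<phi> c)"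
    by (subst sum_rotate3[symmetric]) (simp add: mf.scale_sum_right mult_ac)
  also have "\<dots> = (\<Sum>\<phi>\<in>cols S0. \<Sum>c\<in>UNIV. cst ?s \<bullet> cst (\<Sum>a\<in>UNIV. \<Sum>a'\<in>UNIV. eps a a' c * T (\<phi>(v := a', u := a))) \<bullet> M \<phi> c)"
    unfolding cst_sum mf.scale_sum_right cst_mult ..
  also have "\<dots> = cst ?s \<bullet>
      Zop (\<lambda>\<phi>. \<Sum>a\<in>UNIV. \<Sum>c\<in>UNIV. eps a c (\<phi> t) * T (\<phi>(u := a, v := c))) (w1 @ (b, t) # w2) X"
  proof -
    have "T (\<phi>(t := c, u := a, v := a')) = T (\<phi>(v := a', u := a))" for \<phi> c a a'
      using t uv S by (intro tens_local[OF assms(1)]) auto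
    moreover have "actw (\<phi>(t := c)) (w1 @ (b, t) # w2) X = M \<phi> c" for \<phi> c
      using notin by (simp add: actw_append M_def V_def)
    ultimately show ?thesis
      unfolding Zop_def sets using t
      by (simp add: sum_cols_insert mf.scale_sum_right del: mf.scale_scale)
  qed
  finally show ?thesis .
qed


lemma xg_casimir_left: "(\<Sum>a\<in>UNIV. xg a * (xg a * X)) = [:0, 1:] \<bullet> X"
  using arg_cong[OF xg_casimir, of "\<lambda>A. A * X"] by (simp add: sum_distrib_right mult.assoc)

lemma xg_casimir_right: "(\<Sum>a\<in>UNIV. X * (xg a * xg a)) = [:0, 1:] \<bullet> X"
  using arg_cong[OF xg_casimir, of "\<lambda>A. X * A"] by (simp add: sum_distrib_left mult.assoc)

text \<open>With both legs of the delta outermost, the sum over their common colour is a Casimir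
  element on one side of the inner value, or a bridge around it.\<close>

lemma Zop_delta:
  assumes "tens S T" "S = snd ` set w" "u \<notin> S" "v \<notin> S" "u \<noteq> v"
  shows "Zop (\<lambda>\<phi>. delta (\<phi> u) (\<phi> v) * T \<phi>) ((b, u) # (b', v) # w) X =
    (if b = b' then [:0, 1:] \<bullet> Zop T w X else yop (Zop T w X))"
proof -
  let ?m = "\<lambda>V a c. if b then (if b' then V * xg c * xg a else xg c * V * xg a)
      else (if b' then xg a * V * xg c else xg a * (xg c * V))"
  have collapse: "(\<Sum>c\<in>UNIV. \<Sum>a\<in>UNIV. cst (delta a c) \<bullet> F a c) = (\<Sum>a\<in>UNIV. F a a)" for F
    by (simp add: sum_col delta_def)
  have upd: "T (\<phi>(v := c, u := a)) = T \<phi>" for \<phi> a c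
    using assms by (intro tens_local[OF assms(1)]) auto
  have "Zop (\<lambda>\<phi>. delta (\<phi> u) (\<phi> v) * T \<phi>) ((b, u) # (b', v) # w) X =
     (\<Sum>\<phi>\<in>cols S. \<Sum>c\<in>UNIV. \<Sum>a\<in>UNIV. cst (delta a c) \<bullet> cst (T \<phi>) \<bullet> ?m (actw \<phi> w X) a c)"
    using assms upd
    by (cases b; cases b') (simp_all add: Zop_def sum_cols_insert cst_mult mult.assoc del: mf.scale_scale)
  also have "\<dots> = (\<Sum>\<phi>\<in>cols S. cst (T \<phi>) \<bullet> (\<Sum>a\<in>UNIV. ?m (actw \<phi> w X) a a))"
    unfolding collapse mf.scale_sum_right ..
  also have "\<dots> = (\<Sum>\<phi>\<in>cols S. cst (T \<phi>) \<bullet> (if b = b' then [:0, 1:] \<bullet> actw \<phi> w X else yop (actw \<phi> w X)))"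
    by (cases b; cases b') (simp_all add: xg_casimir_left xg_casimir_right yop_def mult.assoc)
  also have "\<dots> = (if b = b' then [:0, 1:] \<bullet> Zop T w X else yop (Zop T w X))"
    using assms(2) by (simp add: Zop_def mf.scale_sum_right yop_sum yop_smul mult.commute)
  finally show ?thesis .
qed

text \<open>Exchanging the names of the summed colours of u and v turns one word into the other and
  flips the epsilon.\<close>

lemma Zop_eps:
  assumes "tens S T" "S = snd ` set w" "u \<notin> S" "v \<notin> S" "t \<notin> S" "u \<noteq> v" "u \<noteq> t" "v \<noteq> t"
  shows "Zop (\<lambda>\<phi>. eps (\<phi> u) (\<phi> v) (\<phi> t) * T \<phi>) ((b, u) # (b, v) # (b', t) # w) X =
    - Zop (\<lambda>\<phi>. eps (\<phi> u) (\<phi> v) (\<phi> t) * T \<phi>) ((b, v) # (b, u) # (b', t) # w) X"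
proof -
  have upd: "T (\<phi>(t := e, v := c, u := a)) = T \<phi>" for \<phi> a c e
    using assms by (intro tens_local[OF assms(1)]) auto
  let ?m = "\<lambda>V a c. if b then V * (xg c * xg a) else xg a * (xg c * V)"
  define V where "V \<phi> e = (if b' then actw \<phi> w X * xg e else xg e * actw \<phi> w X)" for \<phi> e
  have "Zop (\<lambda>\<phi>. eps (\<phi> u) (\<phi> v) (\<phi> t) * T \<phi>) ((b, u) # (b, v) # (b', t) # w) X =
     (\<Sum>\<phi>\<in>cols S. \<Sum>e\<in>UNIV. \<Sum>c\<in>UNIV. \<Sum>a\<in>UNIV. cst (eps a c e * T \<phi>) \<bullet> ?m (V \<phi> e) a c)"
    using assms upd by (simp add: Zop_def sum_cols_insert V_def mult.assoc cong: if_cong)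
  also have "\<dots> = (\<Sum>\<phi>\<in>cols S. \<Sum>e\<in>UNIV. \<Sum>a\<in>UNIV. \<Sum>c\<in>UNIV. cst (eps a c e * T \<phi>) \<bullet> ?m (V \<phi> e) a c)"
    by (rule sum.cong[OF refl], rule sum.cong[OF refl], rule sum.swap)
  also have "\<dots> = - (\<Sum>\<phi>\<in>cols S. \<Sum>e\<in>UNIV. \<Sum>a\<in>UNIV. \<Sum>c\<in>UNIV. cst (eps c a e * T \<phi>) \<bullet> ?m (V \<phi> e) a c)"
    unfolding sum_negf[symmetric] mf.scale_minus_left[symmetric]
    by (intro sum.cong refl, subst eps_antisym, simp)
  also have "(\<Sum>\<phi>\<in>cols S. \<Sum>e\<in>UNIV. \<Sum>a\<in>UNIV. \<Sum>c\<in>UNIV. cst (eps c a e * T \<phi>) \<bullet> ?m (V \<phi> e) a c)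
     = Zop (\<lambda>\<phi>. eps (\<phi> u) (\<phi> v) (\<phi> t) * T \<phi>) ((b, v) # (b, u) # (b', t) # w) X"
  proof -
    have "snd ` set ((b, v) # (b, u) # (b', t) # w) = insert u (insert v (insert t S))"
      using assms(2) by auto
    then show ?thesis
      unfolding Zop_def using assms upd by (simp add: sum_cols_insert V_def mult.assoc cong: if_cong)
  qed
  finally show ?thesis .
qed

section \<open>Reduction of contracted words to polynomials in c and Y\<close>

text \<open>Adjacent transpositions generate all permutations. \<open>step\<close> is demanded only
  for words with multiset M, because an exchange is justified only for distinct labels that match
  the tensor.\<close>

lemma mset_cong_from_moves:
  assumes step: "\<And>w1 x y w2. mset (w1 @ x # y # w2) = M \<Longrightarrow> G (w1 @ x # y # w2) \<Longrightarrow> G (w1 @ y # x # w2)"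
  assumes "mset w = M" "mset w' = M" "G w"
  shows "G w'"
proof -
  \<comment> \<open>Selection sort: x travels leftwards to the end of the part \<open>pre\<close>
    that is already in place.\<close>
  have move: "G (pre @ w1 @ x # w2) \<Longrightarrow> G (pre @ x # w1 @ w2)"
    if "mset (pre @ w1 @ x # w2) = M" for pre w1 x w2 
    using that
  proof (induction w1 arbitrary: w2 rule: rev_induct)
    case (snoc y w1)
    from step[of "pre @ w1" y x w2] snoc.prems have "G (pre @ w1 @ x # y # w2)" by simp
    with snoc.IH[of "y # w2"] snoc.prems show ?case by (simp add: add_mset_commute)
  qed simp
  have "G (pre @ v) \<Longrightarrow> G (pre @ v')" if "mset (pre @ v) = M" "mset v = mset v'" for pre v v'
    using that
  proof (induction v' arbitrary: pre v)
    case (Cons x v')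
    then have "x \<in> set v" by (metis list.set_intros(1) set_mset_mset)
    then obtain w1 w2 where v: "v = w1 @ x # w2" by (meson split_list)
    have "G (pre @ x # w1 @ w2)" using Cons.prems v by (intro move) auto
    then have "G ((pre @ [x]) @ v')"
      using Cons.prems v by (intro Cons.IH[of "pre @ [x]" "w1 @ w2"]) auto
    then show ?case by simp
  qed simp
  from this[of "[]" w w'] assms show ?thesis by simp
qed

text \<open>Induction on the length absorbs the correction terms of exchanges and the words left
  after removing a delta. An inner induction follows the construction of T, whose sums and multiples
  keep the word.\<close>

lemma good_Zop:
  assumes "tens S T" "distinct (map snd w)" "S = snd ` set w"
  shows "good (Zop T w)"
  using assms
proof (induction "length w" arbitrary: S T w rule: less_induct)
  case less
  \<comment> \<open>Letters on different strands commute exactly; on the same strand the error is a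
    word shorter by one.\<close>
  have swap: "good (Zop T (w1 @ x # y # w2)) \<Longrightarrow> good (Zop T (w1 @ y # x # w2))"
    if "tens S T" "mset (w1 @ x # y # w2) = mset v" "distinct (map snd v)" "S = snd ` set v" "length v = length w"
    for S T v w1 x y w2
  proof -
    assume G: "good (Zop T (w1 @ x # y # w2))"
    obtain b u b' v' where xy: "x = (b, u)" "y = (b', v')" by (cases x, cases y) auto
    have d: "distinct (map snd (w1 @ x # y # w2))" and S: "S = snd ` set (w1 @ x # y # w2)"
      using that(2-4) by (metis mset_map mset_eq_imp_distinct_iff, metis mset_eq_setD)
    show ?thesis
    proof (cases "b' = b")
      case False
      then have "b' = (\<not> b)" by auto
      then have "Zop T (w1 @ y # x # w2) = Zop T (w1 @ x # y # w2)"
        using Zop_swap_different[of T w1 b u v' w2] xy by (auto simp: fun_eq_iff)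
      then show ?thesis using G by simp
    next
      case True
      have fin: "finite S" using that(4) by simp
      then obtain t where t: "t \<notin> S" using ex_new_if_finite[OF _ fin] infinite_UNIV_nat by blast
      let ?T = "\<lambda>\<phi>. \<Sum>a\<in>UNIV. \<Sum>c\<in>UNIV. eps a c (\<phi> t) * T (\<phi>(u := a, v' := c))"
      let ?w = "w1 @ (b, t) # w2"
      have "Zop T (w1 @ y # x # w2) = (\<lambda>X. Zop T (w1 @ x # y # w2) X - cst (if b then - \<i> else \<i>) \<bullet> Zop ?T ?w X)"
        using Zop_swap_same[OF that(1) S[unfolded xy True] d[unfolded xy True] t] xy True
        by (auto simp: fun_eq_iff algebra_simps)
      moreover have "good (Zop ?T ?w)"
      proof (rule less.hyps)
        show "length ?w < length w"
          using that(2,5) by (metis Suc_eq_plus1 add_Suc_right length_Cons length_append lessI mset_eq_length)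
        show "tens (insert t (S - {u, v'})) ?T"
          using S d xy t fin by (intro tens_commutator that(1)) auto
        show "distinct (map snd ?w)" using d t S xy by auto
        show "insert t (S - {u, v'}) = snd ` set ?w" using d S xy by auto
      qed
      ultimately show ?thesis using good_diff[OF G good_smul] by simp
    qed
  qed
  have perm: "good (Zop T v')"
    if "tens S T" "distinct (map snd v)" "S = snd ` set v" "length v = length w" "mset v' = mset v" "good (Zop T v)" for S T v v'
    by (rule mset_cong_from_moves[of "mset v" "\<lambda>v. good (Zop T v)" v v'])
      (use swap[OF that(1) _ that(2-4)] that in auto)
  have "good (Zop T v)" if "tens S T" "distinct (map snd v)" "S = snd ` set v" "length v = length w" for S T v
    using that
  proof (induction rule: tens.induct)
    case one
    then have "v = []" by auto
    then have "Zop (\<lambda>_. 1) v = (\<lambda>X. X)" by (auto simp: Zop_def fun_eq_iff simp flip: one_pCons)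
    then show ?case by (simp add: good_id)
  next
    case (zero S)
    have "Zop (\<lambda>_. 0) v = (\<lambda>X. 0)" by (auto simp: Zop_def fun_eq_iff)
    then show ?case by (simp add: good.zero)
  next
    case (add S T T')
    have "Zop (\<lambda>\<phi>. T \<phi> + T' \<phi>) v = (\<lambda>X. Zop T v X + Zop T' v X)" by (auto simp: Zop_add)
    then show ?case using add good_add by simp
  next
    case (scale S T z)
    have "Zop (\<lambda>\<phi>. z * T \<phi>) v = (\<lambda>X. cst z \<bullet> Zop T v X)" by (auto simp: Zop_scale)
    then show ?case using scale good_smul by simp
  next
    case (delta S T u u')
    let ?T = "\<lambda>\<phi>. delta (\<phi> u) (\<phi> u') * T \<phi>"
    have tens: "tens (insert u (insert u' S)) ?T" using delta.hyps by (rule tens.delta)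
    obtain b b' where b: "(b, u) \<in> set v" "(b', u') \<in> set v"
      using delta.prems(2) by (metis (no_types, lifting) imageE insertI1 insertI2 prod.collapse)
    obtain v1 where v1: "mset v = mset ((b, u) # v1)" using b(1) by (metis mset.simps(2) mset_remove1 insert_DiffM set_mset_mset)
    then have "(b', u') \<in> set v1" using b delta.hyps by (metis Pair_inject mset_eq_setD set_ConsD)
    then obtain r where r: "mset v = mset ((b, u) # (b', u') # r)"
      using v1 by (metis mset.simps(2) mset_remove1 insert_DiffM set_mset_mset)
    let ?v = "(b, u) # (b', u') # r"
    have d: "distinct (map snd ?v)" using delta.prems(1) r by (metis mset_map mset_eq_imp_distinct_iff)
    have s: "insert u (insert u' S) = snd ` set ?v" using delta.prems(2) r by (metis mset_eq_setD)
    have l: "length ?v = length w" using delta.prems(3) r by (metis mset_eq_length)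
    have Sr: "S = snd ` set r" using s d delta.hyps by auto
    have "good (Zop T r)" using l d Sr delta.hyps(1) by (intro less.hyps) auto
    moreover have "Zop ?T ?v = (\<lambda>X. if b = b' then [:0, 1:] \<bullet> Zop T r X else yop (Zop T r X))"
      using Zop_delta[OF delta.hyps(1) Sr delta.hyps(2-4)] by (auto simp: fun_eq_iff)
    ultimately have "good (Zop ?T ?v)" by (cases "b = b'") (simp_all add: good_smul good_yop)
    then show ?case by (rule perm[OF tens d s l r])
  next
    case (eps S T u1 u2 u3)
    let ?T = "\<lambda>\<phi>. eps (\<phi> u1) (\<phi> u2) (\<phi> u3) * T \<phi>"
    let ?S = "insert u1 (insert u2 (insert u3 S))"
    have tens: "tens ?S ?T" using eps.hyps by (rule tens.eps)
    obtain b1 b2 b3 where b: "(b1, u1) \<in> set v" "(b2, u2) \<in> set v" "(b3, u3) \<in> set v"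
      using eps.prems(2) by (metis (no_types, lifting) imageE insertI1 insertI2 prod.collapse)
    text \<open>Two of the three legs of an epsilon lie on the same strand; exchanging them
      changes the sign, but also changes the operator only by a shorter word.\<close>
    obtain b c x y z where p: "(b, x) \<in> set v" "(b, y) \<in> set v" "(c, z) \<in> set v"
      and xyz: "(x, y, z) \<in> {(u1, u2, u3), (u2, u3, u1), (u3, u1, u2)}"
    proof (cases "b1 = b2")
      case True then show thesis using b that by auto
    next
      case False then show thesis using b that by (cases "b2 = b3") auto
    qed
    have ne: "x \<noteq> y" "x \<noteq> z" "y \<noteq> z" "x \<notin> S" "y \<notin> S" "z \<notin> S" "?S = insert x (insert y (insert z S))"
      using xyz eps.hyps by auto
    have T: "?T = (\<lambda>\<phi>. eps (\<phi> x) (\<phi> y) (\<phi> z) * T \<phi>)"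
      using xyz eps_cyclic by auto
    obtain r where r: "mset v = mset ((b, x) # (b, y) # (c, z) # r)"
    proof -
      obtain v1 where v1: "mset v = mset ((b, x) # v1)" using p(1) by (metis mset.simps(2) mset_remove1 insert_DiffM set_mset_mset)
      then have "(b, y) \<in> set v1" using p ne by (metis Pair_inject mset_eq_setD set_ConsD)
      then obtain v2 where v2: "mset v1 = mset ((b, y) # v2)" by (metis mset.simps(2) mset_remove1 insert_DiffM set_mset_mset)
      have "(c, z) \<in> set v1" using p ne v1 by (metis Pair_inject mset_eq_setD set_ConsD)
      then have "(c, z) \<in> set v2" using ne v2 by (metis Pair_inject mset_eq_setD set_ConsD)
      then obtain v3 where v3: "mset v2 = mset ((c, z) # v3)" by (metis mset.simps(2) mset_remove1 insert_DiffM set_mset_mset)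
      from v1 v2 v3 that show thesis by simp
    qed
    let ?v = "(b, x) # (b, y) # (c, z) # r"
    have d: "distinct (map snd ?v)" using eps.prems(1) r by (metis mset_map mset_eq_imp_distinct_iff)
    have s: "?S = snd ` set ?v" using eps.prems(2) r by (metis mset_eq_setD)
    have l: "length ?v = length w" using eps.prems(3) r by (metis mset_eq_length)
    have Sr: "S = snd ` set r" using s d ne by auto
    obtain t where t: "t \<notin> snd ` set ?v"
      using ex_new_if_finite[of "snd ` set ?v"] infinite_UNIV_nat by auto
    have fin: "finite ?S" using s by simp
    let ?T' = "\<lambda>\<phi>. \<Sum>a\<in>UNIV. \<Sum>c\<in>UNIV. eps a c (\<phi> t) * ?T (\<phi>(x := a, y := c))"
    have g: "good (Zop ?T' ((b, t) # (c, z) # r))"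
    proof (rule less.hyps)
      show "length ((b, t) # (c, z) # r) < length w" using l by simp
      show "tens (insert t (?S - {x, y})) ?T'" using ne t s fin by (intro tens_commutator tens) auto
      show "distinct (map snd ((b, t) # (c, z) # r))" using d t by auto
      show "insert t (?S - {x, y}) = snd ` set ((b, t) # (c, z) # r)" using ne Sr by auto
    qed
    \<comment> \<open>The exchanged word is minus the original by antisymmetry and differs from it
      by a shorter word, so twice the original is a multiple of that shorter word.\<close>
    have "cst 2 \<bullet> Zop ?T ?v X = cst (if b then - \<i> else \<i>) \<bullet> Zop ?T' ((b, t) # (c, z) # r) X" for X
    proof -
      have "Zop ?T ?v X - Zop ?T ((b, y) # (b, x) # (c, z) # r) X
          = cst (if b then - \<i> else \<i>) \<bullet> Zop ?T' ((b, t) # (c, z) # r) X"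
        using Zop_swap_same[OF tens, of "[]" b x y "(c, z) # r" t] s d t by simp
      moreover have "Zop ?T ?v X = - Zop ?T ((b, y) # (b, x) # (c, z) # r) X"
        unfolding T by (rule Zop_eps[OF eps.hyps(1) Sr ne(4-6,1-3)])
      moreover have "cst 2 \<bullet> A = A + A" for A
        using cst_add[of 1 1 A] by (simp flip: one_pCons)
      ultimately show ?thesis by simp
    qed
    then have "cst (1/2) \<bullet> cst 2 \<bullet> Zop ?T ?v X = cst (1/2) \<bullet> cst (if b then - \<i> else \<i>) \<bullet> Zop ?T' ((b, t) # (c, z) # r) X" for X
      by simp
    moreover have "cst (1/2) \<bullet> cst 2 \<bullet> A = A" for A by (simp flip: one_pCons)
    ultimately have eq: "Zop ?T ?v = (\<lambda>X. cst (1/2) \<bullet> cst (if b then - \<i> else \<i>) \<bullet> Zop ?T' ((b, t) # (c, z) # r) X)"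
      by (simp only: fun_eq_iff) simp
    have "good (Zop ?T ?v)" by (subst eq) (intro good_smul g)
    then show ?case by (rule perm[OF tens d s l r])
  qed
  then show ?case using less.prems by blast
qed

section \<open>Chords as deltas\<close>

lemma split_first_label:
  "count_list (map snd w) l = Suc n \<Longrightarrow>
    \<exists>w1 b u. w = w1 @ (b, l) # u \<and> l \<notin> snd ` set w1 \<and> count_list (map snd u) l = n"
proof (induction w)
  case (Cons x w)
  obtain b k where x: "x = (b, k)" by (cases x)
  show ?case
  proof (cases "k = l")
    case True
    then show ?thesis using Cons.prems x by (intro exI[of _ "[]"] exI[of _ b] exI[of _ w]) simp
  next
    case False
    then obtain w1 c u where "w = w1 @ (c, l) # u" "l \<notin> snd ` set w1" "count_list (map snd u) l = n"
      using Cons x by auto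
    then show ?thesis using x False by (intro exI[of _ "x # w1"] exI[of _ c] exI[of _ u]) simp
  qed
qed simp

text \<open>A chord is a delta between two separate letters: the second occurrence of its label gets
  a fresh name m. The induction turns the labels in D one by one into legs of T; for shares it
  starts with no legs and T = 1.\<close>

lemma good_Zop_chords:
  assumes "finite D" "tens S T" "S \<inter> D = {}" "snd ` set w = S \<union> D"
    and "\<And>l. l \<in> S \<Longrightarrow> count_list (map snd w) l = 1"
    and "\<And>l. l \<in> D \<Longrightarrow> count_list (map snd w) l = 2"
  shows "good (Zop T w)"
  using assms
proof (induction D arbitrary: S T w rule: finite_induct)
  case empty
  have "distinct (map snd w)"
    unfolding distinct_count_atmost_1 count_mset
    using empty.prems by (auto simp: count_list_0_iff)
  with empty.prems show ?case by (intro good_Zop[of S]) auto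
next
  case (insert l D)
  have "count_list (map snd w) l = Suc 1" using insert.prems by auto
  then obtain w1 b u where w1: "w = w1 @ (b, l) # u" "l \<notin> snd ` set w1" "count_list (map snd u) l = Suc 0"
    using split_first_label[of w l 1] by auto
  then obtain w2 b' w3 where w2: "u = w2 @ (b', l) # w3" "l \<notin> snd ` set w2" "count_list (map snd w3) l = 0"
    using split_first_label[OF w1(3)] by auto
  have l3: "l \<notin> snd ` set w3"
    using w2 by (simp add: count_list_0_iff)
  have w: "w = w1 @ (b, l) # w2 @ (b', l) # w3" using w1 w2 by simp
  obtain m where m: "m \<notin> snd ` set w"
    using ex_new_if_finite[of "snd ` set w"] infinite_UNIV_nat by auto
  let ?w = "w1 @ (b, l) # w2 @ (b', m) # w3"
  let ?T = "\<lambda>\<phi>. delta (\<phi> l) (\<phi> m) * T \<phi>"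
  define S1 where "S1 = snd ` set (w1 @ w2 @ w3)"
  have notin: "l \<notin> S1" "m \<notin> S1" "l \<noteq> m" "l \<notin> S" "m \<notin> S"
    using w m w1(2) w2(2) l3 insert.prems(2,3) by (auto simp: S1_def)
  have "good (Zop ?T ?w)"
  proof (rule insert.IH)
    show "tens (insert l (insert m S)) ?T"
      using insert.prems(1) notin by (intro tens.delta) auto
    show "insert l (insert m S) \<inter> D = {}" using insert m by auto
    have "S1 = S \<union> D" using insert.prems(2,3) insert.hyps w notin by (auto simp: S1_def)
    then show "snd ` set ?w = insert l (insert m S) \<union> D" by (auto simp: S1_def)
    have z: "count_list (map snd v) m = 0" if "v \<in> {w1, w2, w3}" for v
      using that notin(2) by (auto simp: count_list_0_iff S1_def)
    have z': "count_list (map snd v) l = 0" if "v \<in> {w1, w2, w3}" for v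
      using that notin(1) by (auto simp: count_list_0_iff S1_def)
    have same: "count_list (map snd ?w) k = count_list (map snd w) k" if "k \<noteq> l" "k \<noteq> m" for k
      using that w by simp
    show "count_list (map snd ?w) k = 1" if "k \<in> insert l (insert m S)" for k
    proof -
      consider "k = l" | "k = m" | "k \<noteq> l" "k \<noteq> m" by blast
      then show ?thesis
      proof cases
        case 3
        then show ?thesis using that insert.prems(4) by (subst same) auto
      qed (use z z' notin in auto)
    qed
    show "count_list (map snd ?w) k = 2" if "k \<in> D" for k
      using that insert.hyps insert.prems(3,5) m by (subst same) auto
  qed
  moreover have "Zop ?T ?w X = Zop T w X" for X
  proof -
    have sets: "snd ` set w = insert l S1" "snd ` set ?w = insert l (insert m S1)"
      using w by (auto simp: S1_def)
    have collapse: "(\<Sum>c\<in>UNIV. \<Sum>a\<in>UNIV. cst (delta a c * z) \<bullet> F c a) = (\<Sum>a\<in>UNIV. cst z \<bullet> F a a)" for F z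
      by (simp add: sum_col delta_def)
    have T: "T (\<phi>(m := c, l := a)) = T \<phi>" "T (\<phi>(l := a)) = T \<phi>" for \<phi> a c
      using notin by (auto intro!: tens_local[OF insert.prems(1)])
    have nn: "l \<notin> snd ` set w1" "l \<notin> snd ` set w2" "l \<notin> snd ` set w3"
      "m \<notin> snd ` set w1" "m \<notin> snd ` set w2" "m \<notin> snd ` set w3" "m \<noteq> l" "l \<noteq> m"
      using notin by (auto simp: S1_def)
    have aw: "actw (\<phi>(m := a, l := a)) ?w X = actw (\<phi>(l := a)) w X" for \<phi> a
      unfolding w actw_append using nn by (simp add: actw_append)
    have "Zop ?T ?w X = (\<Sum>\<phi>\<in>cols S1. \<Sum>a\<in>UNIV. cst (T \<phi>) \<bullet> actw (\<phi>(l := a)) w X)"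
      unfolding Zop_def sets using notin T by (simp add: sum_cols_insert collapse aw)
    also have "\<dots> = Zop T w X"
      unfolding Zop_def sets using notin T by (simp add: sum_cols_insert)
    finally show ?thesis .
  qed
  ultimately show ?case by (simp add: ext[of "Zop ?T ?w" "Zop T w"])
qed

subsection \<open>The action of shares on matrix families\<close>

definition wd :: "(nat \<Rightarrow> col) \<Rightarrow> nat list \<Rightarrow> mfam" where
  "wd \<phi> w = prod_list (map (\<lambda>l. xg (\<phi> l)) w)"

lemma wd_simps [simp]: "wd \<phi> [] = 1" "wd \<phi> (l # w) = xg (\<phi> l) * wd \<phi> w"
  "wd \<phi> (w @ w') = wd \<phi> w * wd \<phi> w'"
  by (simp_all add: wd_def)

lemma wd_map: "wd \<phi> (map f w) = wd (\<phi> \<circ> f) w"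
  by (simp add: wd_def comp_def)

text \<open>The head of a list is the outermost factor, so the letters to the right of X must be
  listed backwards.\<close>

lemma actw_strands:
  "actw \<phi> (map (Pair False) v @ map (Pair True) (rev w)) X = wd \<phi> v * X * wd \<phi> w"
proof -
  have "actw \<phi> (map (Pair False) v) X = wd \<phi> v * X" for X
    by (induction v) (simp_all add: mult.assoc)
  moreover have "actw \<phi> (map (Pair True) (rev w)) X = X * wd \<phi> w" for X
    by (induction w arbitrary: X) (simp_all add: actw_append mult.assoc)
  ultimately show ?thesis by (simp add: actw_append mult.assoc)
qed

definition labels :: "share \<Rightarrow> nat set" where "labels s = set (fst s) \<union> set (snd s)"

definition acts :: "share \<Rightarrow> mfam \<Rightarrow> mfam" where
  "acts s X = (\<Sum>\<phi>\<in>cols (labels s). wd \<phi> (fst s) * X * wd \<phi> (snd s))"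

lemma good_acts:
  assumes "wf_share s"
  shows "good (acts s)"
proof -
  let ?w = "map (Pair False) (fst s) @ map (Pair True) (rev (snd s))"
  have map: "map snd ?w = fst s @ rev (snd s)" by (simp add: comp_def)
  have set: "snd ` set ?w = labels s" by (auto simp: labels_def image_Un image_image)
  have "good (Zop (\<lambda>_. 1) ?w)"
  proof (rule good_Zop_chords[OF _ tens.one])
    show "finite (labels s)" by (simp add: labels_def)
    show "snd ` set ?w = {} \<union> labels s" using set by simp
    show "count_list (map snd ?w) l = 2" if "l \<in> labels s" for l
      using assms that unfolding map wf_share_def labels_def by auto
  qed auto
  moreover have "Zop (\<lambda>_. 1) ?w = acts s"
    unfolding Zop_def set by (auto simp: acts_def actw_strands)
  ultimately show ?thesis by simp
qed

lemma entry_wd: "entry (wd \<phi> w) d = wordmat d (colnum \<circ> \<phi>) w"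
  by (induction w) (simp_all add: wordmat_def one_mfam.rep_eq times_mfam.rep_eq entry_xg)

lemma wordmat_cong: "(\<And>l. l \<in> set w \<Longrightarrow> \<phi> l = \<psi> l) \<Longrightarrow> wordmat d \<phi> w = wordmat d \<psi> w"
  unfolding wordmat_def by (rule foldr_cong) auto

definition wsum :: "nat list \<Rightarrow> mfam" where "wsum w = (\<Sum>\<phi>\<in>cols (set w). wd \<phi> w)"

lemma entry_wsum: "entry (wsum w) d i k = sl2sum d w i k"
proof -
  define cn where "cn n = (if n = 1 then C1 else if n = 2 then C2 else C3)" for n :: nat
  have cn: "cn (colnum a) = a" "colnum a \<in> {1, 2, 3}" for a by (cases a; simp add: cn_def)+
  have nc: "colnum (cn n) = n" if "n \<in> {1, 2, 3}" for n using that by (auto simp: cn_def)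
  let ?S = "set w"
  have "(\<Sum>\<phi>\<in>cols ?S. wordmat d (colnum \<circ> \<phi>) w i k) = (\<Sum>\<phi>\<in>?S \<rightarrow>\<^sub>E {1,2,3}. wordmat d \<phi> w i k)"
  proof (rule sum.reindex_bij_witness[of _ "\<lambda>\<psi>. restrict (cn \<circ> \<psi>) ?S" "\<lambda>\<phi>. restrict (colnum \<circ> \<phi>) ?S"])
    fix \<phi> assume "\<phi> \<in> cols ?S"
    then show "restrict (cn \<circ> restrict (colnum \<circ> \<phi>) ?S) ?S = \<phi>"
      by (auto simp: cols_def cn fun_eq_iff restrict_def PiE_def extensional_def)
    show "restrict (colnum \<circ> \<phi>) ?S \<in> ?S \<rightarrow>\<^sub>E {1,2,3}" using cn(2) by auto
    show "wordmat d (restrict (colnum \<circ> \<phi>) ?S) w i k = wordmat d (colnum \<circ> \<phi>) w i k"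
      by (rule fun_cong[OF fun_cong[OF wordmat_cong]]) simp
  next
    fix \<psi> assume \<psi>: "\<psi> \<in> ?S \<rightarrow>\<^sub>E {1,2,3::nat}"
    show "restrict (colnum \<circ> restrict (cn \<circ> \<psi>) ?S) ?S = \<psi>"
    proof
      fix l show "restrict (colnum \<circ> restrict (cn \<circ> \<psi>) ?S) ?S l = \<psi> l"
        using \<psi> nc[of "\<psi> l"] by (cases "l \<in> ?S") (auto simp: PiE_def extensional_def)
    qed
    show "restrict (cn \<circ> \<psi>) ?S \<in> cols ?S" by (auto simp: cols_def)
  qed
  then show ?thesis by (simp add: wsum_def entry_sum entry_wd sl2sum_def)
qed

lemma yop_one: "yop 1 = [:0, 1:] \<bullet> 1"
  by (simp add: yop_def xg_casimir)

text \<open>The identity matrix has spin 0: already the first factor Y - c kills it.\<close>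

lemma pop_Suc_one: "pop (Suc n) 1 = 0"
proof (induction n)
  case 0
  show ?case by (simp add: yop_one eig_def)
qed (simp add: pop.simps(2)[of "Suc _"] del: pop.simps)

text \<open>Existence and uniqueness behind the definite description. The diagram, cut open, is
  strand 1 of a share with empty strand 2; applied to the identity matrix only the p_0 term of its
  expansion survives, and the coefficient of that term is the polynomial.\<close>

lemma wsum_eq_w_sl2:
  assumes "\<And>l. l \<in> set w \<Longrightarrow> count_list w l = 2"
  shows "wsum w = w_sl2 w \<bullet> 1"
proof -
  have "good (acts (w, []))" using assms by (intro good_acts) (simp add: wf_share_def)
  then obtain N q where q: "\<And>X. acts (w, []) X = (\<Sum>n<N. q n \<bullet> pop n X)" using good_expansion by blast
  have "wsum w = acts (w, []) 1" by (simp add: acts_def wsum_def labels_def)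
  also have "\<dots> = (\<Sum>n<N. if n = 0 then q 0 \<bullet> 1 else 0)"
    unfolding q by (rule sum.cong) (auto simp: gr0_conv_Suc pop_Suc_one simp del: pop.simps(2))
  also have "\<dots> = (if N > 0 then q 0 else 0) \<bullet> 1" by simp
  finally obtain P where P: "wsum w = P \<bullet> 1" by blast
  have "w_sl2 w = P" unfolding w_sl2_def
  proof (rule the_equality)
    show "\<forall>d\<ge>1. \<forall>i<d. \<forall>k<d. sl2sum d w i k = (if i = k then poly P (casimir_val d) else 0)"
      unfolding entry_wsum[symmetric] P by (simp add: smul.rep_eq one_mfam.rep_eq mid_def)
  next
    fix Q assume Q: "\<forall>d\<ge>1. \<forall>i<d. \<forall>k<d. sl2sum d w i k = (if i = k then poly Q (casimir_val d) else 0)"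
    have "Q - P = 0"
    proof (rule poly_casimir_zero_imp[of 0])
      fix d :: nat assume "d > 0"
      then have "sl2sum d w 0 0 = poly Q (casimir_val d)" using Q by auto
      moreover have "sl2sum d w 0 0 = poly P (casimir_val d)"
        unfolding entry_wsum[symmetric] P using \<open>d > 0\<close> by (simp add: smul.rep_eq one_mfam.rep_eq mid_def)
      ultimately show "poly (Q - P) (casimir_val d) = 0" by simp
    qed
    then show "Q = P" by simp
  qed
  then show ?thesis using P by simp
qed

text \<open>Even and odd labels keep two shares apart, so a colouring of the union is a pair of
  independent colourings; \<open>mix\<close> interleaves them.\<close>

lemma sum_cols_lab:
  "(\<Sum>\<phi>\<in>cols (lab1 ` A \<union> lab2 ` B). F (\<phi> \<circ> lab1) (\<phi> \<circ> lab2)) = (\<Sum>\<alpha>\<in>cols A. \<Sum>\<beta>\<in>cols B. F \<alpha> \<beta>)"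
proof -
  have lab: "lab1 ` A \<inter> lab2 ` B = {}" "inj lab1" "inj lab2"
    by (auto simp: lab1_def lab2_def inj_def) presburger
  define mix :: "(nat \<Rightarrow> col) \<times> (nat \<Rightarrow> col) \<Rightarrow> nat \<Rightarrow> col" where
    "mix p l = (if even l then fst p (l div 2) else snd p (l div 2))" for p l
  have m1: "mix p \<circ> lab1 = fst p" "mix p \<circ> lab2 = snd p" for p
    by (auto simp: mix_def lab1_def lab2_def fun_eq_iff)
  have m2: "mix (\<phi> \<circ> lab1, \<phi> \<circ> lab2) = \<phi>" for \<phi>
    by (auto simp: mix_def lab1_def lab2_def fun_eq_iff)
  have "(\<Sum>\<phi>\<in>cols (lab1 ` A \<union> lab2 ` B). F (\<phi> \<circ> lab1) (\<phi> \<circ> lab2)) = (\<Sum>p\<in>cols A \<times> cols B. F (fst p) (snd p))"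
  proof (rule sum.reindex_bij_witness[of _ mix "\<lambda>\<phi>. (\<phi> \<circ> lab1, \<phi> \<circ> lab2)"])
    fix \<phi> assume "\<phi> \<in> cols (lab1 ` A \<union> lab2 ` B)"
    then have "\<phi> l = undefined" if "l \<notin> lab1 ` A \<union> lab2 ` B" for l
      using that by (auto simp: cols_def PiE_def extensional_def)
    moreover have "lab1 l \<notin> lab2 ` B" "lab2 l \<notin> lab1 ` A" for l
      by (auto simp: lab1_def lab2_def) presburger+
    ultimately show "(\<phi> \<circ> lab1, \<phi> \<circ> lab2) \<in> cols A \<times> cols B"
      using lab by (auto simp: cols_def PiE_def extensional_def inj_image_mem_iff)
  next
    fix p assume p: "p \<in> cols A \<times> cols B"
    have "mix p l = undefined" if "l \<notin> lab1 ` A \<union> lab2 ` B" for l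
    proof (cases "even l")
      case True
      then have "l = lab1 (l div 2)" by (simp add: lab1_def)
      then have "l div 2 \<notin> A" using that by (metis UnCI image_eqI)
      then show ?thesis using p True by (auto simp: mix_def cols_def PiE_def extensional_def)
    next
      case False
      then have "l = lab2 (l div 2)" by (simp add: lab2_def)
      then have "l div 2 \<notin> B" using that by (metis UnCI image_eqI)
      then show ?thesis using p False by (auto simp: mix_def cols_def PiE_def extensional_def)
    qed
    then show "mix p \<in> cols (lab1 ` A \<union> lab2 ` B)" by (simp add: cols_def PiE_def extensional_def)
  qed (auto simp: m1 m2)
  then show ?thesis by (simp add: sum.cartesian_product case_prod_unfold)
qed

text \<open>On the circle, cut before strand 1 of s, the strands of s enclose strand 1 of t, and
  strand 2 of t closes up.\<close>

lemma wsum_join: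
  "wsum (join_share s t) = (\<Sum>\<beta>\<in>cols (labels t). acts s (wd \<beta> (fst t)) * wd \<beta> (snd t))"
proof -
  have "set (join_share s t) = lab1 ` labels s \<union> lab2 ` labels t"
    by (auto simp: join_share_def labels_def)
  then have "wsum (join_share s t) = (\<Sum>\<phi>\<in>cols (lab1 ` labels s \<union> lab2 ` labels t).
      wd (\<phi> \<circ> lab1) (fst s) * wd (\<phi> \<circ> lab2) (fst t) * wd (\<phi> \<circ> lab1) (snd s) * wd (\<phi> \<circ> lab2) (snd t))"
    by (simp add: wsum_def join_share_def wd_map mult.assoc)
  also have "\<dots> = (\<Sum>\<alpha>\<in>cols (labels s). \<Sum>\<beta>\<in>cols (labels t). wd \<alpha> (fst s) * wd \<beta> (fst t) * wd \<alpha> (snd s) * wd \<beta> (snd t))"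
    by (rule sum_cols_lab)
  finally show ?thesis
    by (subst (asm) sum.swap) (simp add: acts_def sum_distrib_right)
qed

text \<open>In the cross product t is nested inside s on both strands.\<close>

lemma acts_cross: "acts (cross_share s t) X = acts s (acts t X)"
proof -
  have "labels (cross_share s t) = lab1 ` labels s \<union> lab2 ` labels t"
    by (auto simp: cross_share_def labels_def)
  then have "acts (cross_share s t) X = (\<Sum>\<phi>\<in>cols (lab1 ` labels s \<union> lab2 ` labels t).
      wd (\<phi> \<circ> lab1) (fst s) * (wd (\<phi> \<circ> lab2) (fst t) * X * wd (\<phi> \<circ> lab2) (snd t)) * wd (\<phi> \<circ> lab1) (snd s))"
    by (simp add: acts_def cross_share_def wd_map mult.assoc)
  also have "\<dots> = (\<Sum>\<alpha>\<in>cols (labels s). \<Sum>\<beta>\<in>cols (labels t).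
      wd \<alpha> (fst s) * (wd \<beta> (fst t) * X * wd \<beta> (snd t)) * wd \<alpha> (snd s))"
    by (rule sum_cols_lab)
  finally show ?thesis
    by (simp add: acts_def sum_distrib_right sum_distrib_left)
qed

lemma count_list_lab:
  "count_list (map lab1 u) (lab1 l) = count_list u l" "count_list (map lab2 u) (lab2 l) = count_list u l"
  "count_list (map lab1 u) (lab2 l) = 0" "count_list (map lab2 u) (lab1 l) = 0"
proof -
  show "count_list (map lab1 u) (lab1 l) = count_list u l" "count_list (map lab2 u) (lab2 l) = count_list u l"
    by (induction u) (auto simp: lab1_def lab2_def)
  have "lab1 k \<noteq> lab2 l" for k l by (simp add: lab1_def lab2_def) presburger
  from this this[symmetric] show "count_list (map lab1 u) (lab2 l) = 0" "count_list (map lab2 u) (lab1 l) = 0"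
    by (auto simp: count_list_0_iff)
qed

lemma wf_cross_share: "wf_share s \<Longrightarrow> wf_share t \<Longrightarrow> wf_share (cross_share s t)"
  unfolding wf_share_def cross_share_def by (auto simp: count_list_lab)

lemma count_join_share:
  "wf_share s \<Longrightarrow> wf_share t \<Longrightarrow> l \<in> set (join_share s t) \<Longrightarrow> count_list (join_share s t) l = 2"
  unfolding wf_share_def join_share_def by (auto simp: count_list_lab)

section \<open>Linear combinations of shares as operators\<close>

abbreviation "lk \<equiv> Poly_Mapping.lookup"
abbreviation "ks \<equiv> Poly_Mapping.keys"

definition act :: "a2 \<Rightarrow> mfam \<Rightarrow> mfam" where
  "act I X = (\<Sum>s\<in>ks I. cst (lk I s) \<bullet> acts s X)"

lemma act_superset: "finite A \<Longrightarrow> ks I \<subseteq> A \<Longrightarrow> act I X = (\<Sum>s\<in>A. cst (lk I s) \<bullet> acts s X)"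
  unfolding act_def by (rule sum.mono_neutral_left) (auto simp: in_keys_iff)

lemma act_zero [simp]: "act 0 X = 0"
  by (simp add: act_def)

lemma act_add: "act (I + J) X = act I X + act J X"
proof -
  let ?A = "ks I \<union> ks J"
  have "act (I + J) X = (\<Sum>s\<in>?A. cst (lk (I + J) s) \<bullet> acts s X)"
    by (rule act_superset) (auto simp: keys_add)
  then show ?thesis
    by (simp add: act_superset[of ?A I] act_superset[of ?A J] lookup_add cst_add sum.distrib)
qed

lemma act_sum: "act (\<Sum>i\<in>S. f i) X = (\<Sum>i\<in>S. act (f i) X)"
  by (induction S rule: infinite_finite_induct) (simp_all add: act_add)

lemma act_diff: "act (I - J) X = act I X - act J X"
  using act_add[of "I - J" J X] by simp

lemma act_single: "act (Poly_Mapping.single s a) X = cst a \<bullet> acts s X"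
  by (cases "a = 0") (simp_all add: act_def)

lemma act_scale: "act (a2_scale a I) X = cst a \<bullet> act I X"
  by (simp add: a2_scale_def act_sum act_single act_def[of I] mf.scale_sum_right mult.commute)

lemma acts_smul: "acts s (p \<bullet> X) = p \<bullet> acts s X"
  by (simp add: acts_def mf.scale_sum_right)

lemma acts_sum: "acts s (\<Sum>i\<in>S. f i) = (\<Sum>i\<in>S. acts s (f i))"
  by (simp add: acts_def sum_distrib_left sum_distrib_right) (rule sum.swap)

lemma act_cross: "act (a2_cross I H) X = act I (act H X)"
  by (simp add: a2_cross_def act_sum act_single acts_cross acts_sum acts_smul
      act_def[of I] act_def[of H] mf.scale_sum_right mult.commute)

lemma act_one: "act a2_one X = X"
  by (simp add: a2_one_def act_single acts_def labels_def)

lemma act_bridge: "act bridge X = yop X"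
  by (simp add: bridge_def act_single acts_def labels_def sum_cols_insert yop_def)

lemma act_arch: "act arch X = [:0, 1:] \<bullet> X"
  by (simp add: arch_def act_single acts_def labels_def sum_cols_insert mult.assoc xg_casimir_left)

lemma act_arch_pow: "act (a2_pow arch i) X = [:0, 1:] ^ i \<bullet> X"
  by (induction i) (simp_all add: a2_pow_def act_one act_cross act_arch)

lemma act_cpoly: "act (cpoly q) X = q \<bullet> X"
proof -
  have "act (cpoly q) X = (\<Sum>i\<le>degree q. monom (coeff q i) i \<bullet> X)"
    by (simp add: cpoly_def act_sum act_scale act_arch_pow monom_altdef mult.commute)
  also have "\<dots> = q \<bullet> X"
    by (simp add: poly_as_sum_of_monoms flip: mf.scale_sum_left)
  finally show ?thesis .
qed

lemma pop_diff: "pop n (X - Z) = pop n X - pop n Z"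
  using pop_add[of n "X - Z" Z] by simp

lemma act_pfac: "act (pfac m) X = yop X - eig m \<bullet> X"
proof -
  have "eig m = [:0, 1:] - cst (of_nat (m * (m + 1)) / 2)" by (simp add: eig_def)
  then show ?thesis
    unfolding pfac_def act_add act_diff act_scale act_one act_bridge act_arch
    by (simp only: mf.scale_left_diff_distrib) simp
qed

lemma pop_Suc_commute: "pop (Suc n) X = pop n (yop X - eig n \<bullet> X)"
  by (simp add: pop_diff pop_smul pop_yop)

lemma act_pp: "act (pp n) X = pop n X"
proof -
  \<comment> \<open>\<open>[0..<Suc n]\<close> puts its new factor next to the accumulator, so A has
    to be arbitrary.\<close>
  have "act (foldr (\<lambda>m acc. a2_cross (pfac m) acc) [0..<n] A) X = pop n (act A X)" for A
    by (induction n arbitrary: A) (simp_all add: act_cross act_pfac pop_diff pop_smul pop_yop)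
  then show ?thesis by (simp add: pp_def act_one)
qed

subsection \<open>Well-formed combinations\<close>

lemma wf_a2_zero: "wf_a2 0"
  by (simp add: wf_a2_def)

lemma wf_a2_add: "wf_a2 I \<Longrightarrow> wf_a2 J \<Longrightarrow> wf_a2 (I + J)"
  unfolding wf_a2_def using keys_add[of I J] by blast

lemma wf_a2_diff: "wf_a2 I \<Longrightarrow> wf_a2 J \<Longrightarrow> wf_a2 (I - J)"
  unfolding wf_a2_def using keys_diff[of I J] by blast

lemma wf_a2_sum: "(\<And>i. i \<in> S \<Longrightarrow> wf_a2 (f i)) \<Longrightarrow> wf_a2 (\<Sum>i\<in>S. f i)"
  by (induction S rule: infinite_finite_induct) (simp_all add: wf_a2_add wf_a2_zero)

lemma wf_a2_single: "wf_share s \<Longrightarrow> wf_a2 (Poly_Mapping.single s a)"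
  by (simp add: wf_a2_def)

lemma wf_a2_scale: "wf_a2 I \<Longrightarrow> wf_a2 (a2_scale a I)"
  unfolding a2_scale_def by (intro wf_a2_sum wf_a2_single) (simp add: wf_a2_def)

lemma wf_a2_cross: "wf_a2 I \<Longrightarrow> wf_a2 H \<Longrightarrow> wf_a2 (a2_cross I H)"
  unfolding a2_cross_def by (intro wf_a2_sum wf_a2_single wf_cross_share) (simp_all add: wf_a2_def)

lemma wf_a2_basic: "wf_a2 a2_one" "wf_a2 arch" "wf_a2 bridge"
  by (simp_all add: a2_one_def arch_def bridge_def wf_a2_single wf_share_def)

lemma wf_a2_cpoly: "wf_a2 (cpoly q)"
proof -
  have "wf_a2 (a2_pow arch i)" for i
    by (induction i) (simp_all add: a2_pow_def wf_a2_basic wf_a2_cross)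
  then show ?thesis unfolding cpoly_def by (intro wf_a2_sum wf_a2_scale)
qed

lemma wf_a2_pp: "wf_a2 (pp n)"
proof -
  have "wf_a2 (pfac m)" for m
    unfolding pfac_def by (intro wf_a2_add wf_a2_diff wf_a2_scale wf_a2_basic)
  then have "wf_a2 (foldr (\<lambda>m acc. a2_cross (pfac m) acc) ms a2_one)" for ms
    by (induction ms) (simp_all add: wf_a2_basic wf_a2_cross)
  then show ?thesis by (simp add: pp_def)
qed

lemma good_act: "wf_a2 I \<Longrightarrow> good (act I)"
proof -
  assume "wf_a2 I"
  then have "good (\<lambda>X. \<Sum>s\<in>ks I. cst (lk I s) \<bullet> acts s X)"
    by (intro good_sum good_smul good_acts) (simp add: wf_a2_def)
  then show ?thesis by (simp add: act_def[abs_def])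
qed

section \<open>The form expressed through the action\<close>

lemma a2_form_smul:
  assumes "wf_a2 I" "wf_a2 H"
  shows "a2_form I H \<bullet> 1 = (\<Sum>s\<in>ks I. \<Sum>t\<in>ks H. cst (lk I s) \<bullet> cst (lk H t) \<bullet> wsum (join_share s t))"
proof -
  have f1: "smult (a * b) p \<bullet> 1 = cst a \<bullet> cst b \<bullet> p \<bullet> 1" for a b p
    by (simp add: mult.commute)
  have f2: "w_sl2 (join_share s t) \<bullet> 1 = wsum (join_share s t)" if "s \<in> ks I" "t \<in> ks H" for s t
    using that assms by (intro wsum_eq_w_sl2[symmetric] count_join_share) (auto simp: wf_a2_def)
  show ?thesis
    unfolding a2_form_def mf.scale_sum_left by (intro sum.cong refl) (simp only: f1 f2)
qed

lemma a2_form_eq: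
  assumes "wf_a2 I" "wf_a2 H"
  shows "a2_form I H \<bullet> 1 =
    (\<Sum>t\<in>ks H. cst (lk H t) \<bullet> (\<Sum>\<beta>\<in>cols (labels t). act I (wd \<beta> (fst t)) * wd \<beta> (snd t)))"
proof -
  have inner: "(\<Sum>s\<in>ks I. cst (lk I s) \<bullet> wsum (join_share s t)) =
      (\<Sum>\<beta>\<in>cols (labels t). act I (wd \<beta> (fst t)) * wd \<beta> (snd t))" for t
    unfolding wsum_join mf.scale_sum_right act_def sum_distrib_right
    by (subst sum.swap) simp
  have "a2_form I H \<bullet> 1 = (\<Sum>t\<in>ks H. \<Sum>s\<in>ks I. cst (lk I s) \<bullet> cst (lk H t) \<bullet> wsum (join_share s t))"
    unfolding a2_form_smul[OF assms] by (rule sum.swap)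
  also have "\<dots> = (\<Sum>t\<in>ks H. cst (lk H t) \<bullet> (\<Sum>s\<in>ks I. cst (lk I s) \<bullet> wsum (join_share s t)))"
    by (simp add: mf.scale_sum_right mult.commute)
  finally show ?thesis unfolding inner .
qed

text \<open>By \<open>a2_form_eq\<close> the form sees its first argument only through its
  action.\<close>

lemma a2_sim_if_act_eq:
  assumes "wf_a2 I" "wf_a2 J" "\<And>X. act I X = act J X"
  shows "a2_sim I J"
  unfolding a2_sim_def
proof (intro allI impI)
  fix H assume "wf_share H"
  then have "wf_a2 (Poly_Mapping.single H 1)" by (rule wf_a2_single)
  then show "a2_form I (Poly_Mapping.single H 1) = a2_form J (Poly_Mapping.single H 1)"
    using assms by (subst smul_one_cancel[symmetric]) (simp only: a2_form_eq)
qed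


subsection \<open>The word-length filtration\<close>

text \<open>Combinations over C[c] of words with at most k generators; they stand for the sum of the
  spins 0 to k under the adjoint action.\<close>

inductive fil :: "nat \<Rightarrow> mfam \<Rightarrow> bool" where
  one: "fil 0 1"
| zero: "fil k 0"
| add: "fil k X \<Longrightarrow> fil k Z \<Longrightarrow> fil k (X + Z)"
| smul: "fil k X \<Longrightarrow> fil k (p \<bullet> X)"
| gen: "fil k X \<Longrightarrow> fil (Suc k) (xg a * X)"
| mono: "fil k X \<Longrightarrow> fil (Suc k) X"

lemma fil_diff: "fil k X \<Longrightarrow> fil k Z \<Longrightarrow> fil k (X - Z)"
  using fil.add[OF _ fil.smul[of k Z "- 1"], of X] by simp

lemma fil_sum: "(\<And>s. s \<in> S \<Longrightarrow> fil k (f s)) \<Longrightarrow> fil k (\<Sum>s\<in>S. f s)"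
  by (induction S rule: infinite_finite_induct) (auto intro: fil.intros)

lemma fil_wd: "fil (length w) (wd \<phi> w)"
  by (induction w) (auto intro: fil.intros)

definition ad :: "col \<Rightarrow> mfam \<Rightarrow> mfam" where "ad a X = xg a * X - X * xg a"

lemma ad_xg: "ad a (xg b) = (\<Sum>t\<in>UNIV. cst (\<i> * eps a b t) \<bullet> xg t)"
  by (simp add: ad_def xg_commute)

lemma ad_mult: "ad a (X * Z) = ad a X * Z + X * ad a Z"
  by (simp add: ad_def algebra_simps mult.assoc)

lemma ad_linear [simp]: "ad a 0 = 0" "ad a 1 = 0" "ad a (X + Z) = ad a X + ad a Z" "ad a (p \<bullet> X) = p \<bullet> ad a X"
  by (simp_all add: ad_def distrib_left distrib_right mf.scale_right_diff_distrib)

lemma fil_ad_xg_mult: "fil k X \<Longrightarrow> fil (Suc k) (ad a (xg b) * X)"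
  unfolding ad_xg sum_distrib_right smul_mult_left by (intro fil_sum fil.smul fil.gen)

lemma fil_ad: "fil k X \<Longrightarrow> fil k (ad a X)"
  by (induction rule: fil.induct) (auto simp: ad_mult intro: fil.intros fil_ad_xg_mult)

text \<open>The cross term in the Leibniz rule for the adjoint Casimir applied to a product with xg b.\<close>

definition crossop :: "col \<Rightarrow> mfam \<Rightarrow> mfam" where
  "crossop b X = (\<Sum>a\<in>UNIV. ad a (xg b) * ad a X)"

text \<open>The contraction of two structure constants as in \<open>eps_eps\<close>: one pair of
  deltas yields the Casimir element, the other exchanges the letters.\<close>

lemma ad_ad_identity:
  "(\<Sum>a\<in>UNIV. ad a (xg b) * ad a (xg g)) = xg g * xg b - cst (delta b g) \<bullet> [:0, 1:] \<bullet> 1"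
  unfolding xg_casimir[symmetric]
  by (cases b; cases g; rule mfam_eqI)
    (simp_all del: xg.simps add: ad_xg sum_col delta_def entry_simps)

lemma crossop_linear [simp]: "crossop b 0 = 0" "crossop b 1 = 0"
  "crossop b (X + Z) = crossop b X + crossop b Z" "crossop b (p \<bullet> X) = p \<bullet> crossop b X"
  by (simp_all add: crossop_def distrib_left sum.distrib mf.scale_sum_right)

text \<open>Leibniz rule for the second factor, after which x_g is carried to the left; the final
  sum collects the commutators that this costs.\<close>

lemma crossop_xg_mult:
  "crossop b (xg g * X) = xg g * xg b * X - cst (delta b g) \<bullet> [:0, 1:] \<bullet> X + xg g * crossop b X
    + (\<Sum>a\<in>UNIV. (ad a (xg b) * xg g - xg g * ad a (xg b)) * ad a X)"
proof -
  have "crossop b (xg g * X) = (\<Sum>a\<in>UNIV. ad a (xg b) * ad a (xg g)) * X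
     + xg g * crossop b X + (\<Sum>a\<in>UNIV. (ad a (xg b) * xg g - xg g * ad a (xg b)) * ad a X)"
    unfolding crossop_def sum_distrib_right sum_distrib_left sum.distrib[symmetric]
    by (rule sum.cong) (simp_all add: ad_mult algebra_simps mult.assoc)
  then show ?thesis unfolding ad_ad_identity by (simp add: left_diff_distrib)
qed

text \<open>Up to shorter words each of the k letters g contributes x_g x_b, that is, an x_b that
  may be moved to the front. Each of the two terms may have length k + 1; their difference has
  length at most k.\<close>

lemma fil_crossop: "fil k X \<Longrightarrow> fil k (crossop b X - cst (of_nat k) \<bullet> (xg b * X))"
proof (induction rule: fil.induct)
  case (add k X Z)
  from fil.add[OF add.IH] show ?case by (simp add: algebra_simps mf.scale_right_distrib)
next
  case (smul k X p)
  from fil.smul[OF smul.IH, of p] show ?case by (simp add: mf.scale_right_diff_distrib mult.commute)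
next
  case (mono k X)
  have "fil (Suc k) ((crossop b X - cst (of_nat k) \<bullet> (xg b * X)) - xg b * X)"
    using mono by (intro fil_diff fil.mono[OF mono.IH] fil.gen)
  then show ?case by (simp add: cst_add algebra_simps)
next
  case (gen k X g)
  have "crossop b (xg g * X) - cst (of_nat (Suc k)) \<bullet> (xg b * (xg g * X)) =
     xg g * (crossop b X - cst (of_nat k) \<bullet> (xg b * X)) - cst (delta b g) \<bullet> [:0, 1:] \<bullet> X
     - cst (of_nat (Suc k)) \<bullet> (ad b (xg g) * X)
     + (\<Sum>a\<in>UNIV. (ad a (xg b) * xg g - xg g * ad a (xg b)) * ad a X)"
    unfolding crossop_xg_mult ad_def[of b]
    by (simp add: cst_add algebra_simps mf.scale_right_diff_distrib mult.assoc)
  moreover have "fil (Suc k) ((ad a (xg b) * xg g - xg g * ad a (xg b)) * ad a X)" for a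
  proof -
    \<comment> \<open>A double commutator of generators is again linear in the generators, so this
      term has one letter fewer than it seems.\<close>
    have "(ad a (xg b) * xg g - xg g * ad a (xg b)) = (\<Sum>t\<in>UNIV. cst (\<i> * eps a b t) \<bullet> ad t (xg g))"
      unfolding ad_xg[of a b] by (simp add: ad_def sum_distrib_left sum_distrib_right mf.scale_right_diff_distrib sum_subtractf)
    then show ?thesis
      using gen.hyps by (simp add: sum_distrib_right) (intro fil_sum fil.smul fil_ad_xg_mult fil_ad)
  qed
  moreover have "fil (Suc k) (cst (delta b g) \<bullet> [:0, 1:] \<bullet> X)" using gen.hyps by (intro fil.smul fil.mono)
  ultimately show ?case
    using gen fil_ad_xg_mult by (auto intro!: fil.add fil_diff fil.gen fil_sum fil.smul[where p = "cst _"])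
qed (auto intro: fil.intros)

text \<open>The left x_a is pushed past x_b, then the right x_a past X. The middle coefficient is
  half the adjoint Casimir value of x_b, which has spin 1: 1(1+1)/2 = 1.\<close>

lemma yop_xg_mult: "yop (xg b * X) = xg b * yop X - xg b * X - crossop b X"
proof -
  have *: "(\<Sum>a\<in>UNIV. ad a (xg b) * xg a) = - xg b"
  proof -
    have "xg C1 * xg C2 = xg C2 * xg C1 + cst \<i> \<bullet> xg C3" "xg C2 * xg C3 = xg C3 * xg C2 + cst \<i> \<bullet> xg C1"
      "xg C3 * xg C1 = xg C1 * xg C3 + cst \<i> \<bullet> xg C2"
      using xg_commute[of C1 C2] xg_commute[of C2 C3] xg_commute[of C3 C1]
      by (simp_all del: xg.simps add: sum_col algebra_simps)
    then show ?thesis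
      by (cases b; intro mfam_eqI) (simp_all del: xg.simps add: ad_xg sum_col entry_simps algebra_simps)
  qed
  have "yop (xg b * X) = (\<Sum>a\<in>UNIV. xg b * (xg a * X * xg a) + ad a (xg b) * xg a * X - ad a (xg b) * ad a X)"
    unfolding yop_def by (rule sum.cong) (simp_all add: ad_def algebra_simps mult.assoc)
  also have "\<dots> = xg b * yop X + (\<Sum>a\<in>UNIV. ad a (xg b) * xg a) * X - crossop b X"
    by (simp add: sum.distrib sum_subtractf sum_distrib_left sum_distrib_right yop_def crossop_def)
  finally show ?thesis unfolding * by simp
qed

lemma eig_Suc: "eig k - eig (Suc k) = cst (of_nat (Suc k))"
  by (simp add: eig_def field_simps)

text \<open>Modulo shorter words Y is the scalar \<open>eig k\<close> on words of length k. A
  further letter lowers it by k + 1: k from \<open>fil_crossop\<close> and 1 from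
  \<open>yop_xg_mult\<close>. For k = 0 there is no lower layer, so the equality is exact.\<close>

lemma fil_yop: "fil k X \<Longrightarrow> case k of 0 \<Rightarrow> yop X = eig 0 \<bullet> X | Suc j \<Rightarrow> fil j (yop X - eig k \<bullet> X)"
proof (induction rule: fil.induct)
  case one
  then show ?case by (simp add: yop_one eig_def)
next
  case (add k X Z)
  show ?case
  proof (cases k)
    case 0
    then show ?thesis using add by (simp add: yop_add mf.scale_right_distrib)
  next
    case (Suc j)
    then have "fil j ((yop X - eig k \<bullet> X) + (yop Z - eig k \<bullet> Z))" using add by (auto intro: fil.add)
    then show ?thesis using Suc by (simp add: yop_add mf.scale_right_distrib algebra_simps)
  qed
next
  case (smul k X p)
  show ?case
  proof (cases k)
    case 0
    then show ?thesis using smul by (simp add: yop_smul mult.commute)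
  next
    case (Suc j)
    then have "fil j (p \<bullet> (yop X - eig k \<bullet> X))" using smul by (auto intro: fil.smul)
    then show ?thesis using Suc by (simp add: yop_smul mf.scale_right_diff_distrib mult.commute)
  qed
next
  case (gen k X b)
  have "yop (xg b * X) - eig (Suc k) \<bullet> (xg b * X) = xg b * (yop X - eig k \<bullet> X)
     + (eig k - eig (Suc k)) \<bullet> (xg b * X) - xg b * X - crossop b X"
    unfolding yop_xg_mult mf.scale_left_diff_distrib by (simp add: right_diff_distrib)
  also have "\<dots> = xg b * (yop X - eig k \<bullet> X) - (crossop b X - cst (of_nat k) \<bullet> (xg b * X))"
    unfolding eig_Suc by (simp add: cst_add)
  finally have *: "yop (xg b * X) - eig (Suc k) \<bullet> (xg b * X) = \<dots>" .
  have "fil k (xg b * (yop X - eig k \<bullet> X))"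
    using gen.IH by (cases k) (auto intro: fil.intros)
  then show ?case using fil_crossop[OF gen.hyps] by (simp add: * fil_diff)
next
  case (mono k X)
  have "fil k (yop X - eig k \<bullet> X)" using mono.IH by (cases k) (auto intro: fil.intros)
  then have "fil k ((yop X - eig k \<bullet> X) + (eig k - eig (Suc k)) \<bullet> X)"
    by (intro fil.add fil.smul mono.hyps)
  then show ?case by (simp add: mf.scale_left_diff_distrib)
qed (simp_all add: fil.zero split: nat.split)

text \<open>The factors Y - \<open>eig k\<close>, ..., Y - \<open>eig 0\<close>, applied in this
  order, shorten the words step by step and finally kill the scalars; further factors preserve
  0.\<close>

lemma pop_kills_fil: "fil k X \<Longrightarrow> k < n \<Longrightarrow> pop n X = 0"
proof -
  assume "fil k X"
  then have Suc: "pop (Suc k) X = 0"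
  proof (induction k arbitrary: X)
    case 0
    from fil_yop[OF this] show ?case by simp
  next
    case (Suc k)
    from fil_yop[OF Suc.prems] have "fil k (yop X - eig (Suc k) \<bullet> X)" by simp
    from Suc.IH[OF this] show ?case
      using pop_Suc_commute[of "Suc k" X] by simp
  qed
  assume "k < n"
  then have "Suc k \<le> n" by simp
  then show ?thesis
  proof (induction rule: dec_induct)
    case base
    show ?case by (rule Suc)
  qed simp
qed

subsection \<open>Traces and adjoints\<close>

definition tr :: "nat \<Rightarrow> mfam \<Rightarrow> complex" where "tr d X = (\<Sum>i<d. entry X d i i)"

lemma tr_linear: "tr d (X + Z) = tr d X + tr d Z" "tr d (X - Z) = tr d X - tr d Z"
  "tr d (p \<bullet> X) = poly p (casimir_val d) * tr d X" "tr d 0 = 0"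
  by (simp_all add: tr_def entry_simps sum.distrib sum_subtractf sum_distrib_left)

lemma tr_sum: "tr d (\<Sum>s\<in>S. f s) = (\<Sum>s\<in>S. tr d (f s))"
  by (induction S rule: infinite_finite_induct) (simp_all add: tr_linear)

lemma tr_one: "tr d 1 = of_nat d"
  by (simp add: tr_def one_mfam.rep_eq mid_def)

lemma tr_mult_commute: "tr d (X * Z) = tr d (Z * X)"
  unfolding tr_def times_mfam.rep_eq mmul_def by (subst sum.swap) (simp add: mult.commute)

text \<open>Cyclicity moves the outer x_a around: the bridge is symmetric for the trace
  form.\<close>

lemma tr_yop: "tr d (yop X * Z) = tr d (X * yop Z)"
proof -
  have "tr d (xg a * X * xg a * Z) = tr d (X * (xg a * Z * xg a))" for a
    using tr_mult_commute[of d "xg a" "X * xg a * Z"] by (simp add: mult.assoc)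
  then show ?thesis by (simp add: yop_def sum_distrib_left sum_distrib_right tr_sum)
qed

lemma tr_pop: "tr d (pop n X * Z) = tr d (X * pop n Z)"
proof (induction n arbitrary: Z)
  case (Suc n)
  have "tr d (pop (Suc n) X * Z) = tr d (pop n X * (yop Z - eig n \<bullet> Z))"
    by (simp add: left_diff_distrib right_diff_distrib tr_linear tr_yop)
  then show ?case by (simp add: Suc.IH pop_Suc_commute del: pop.simps)
qed simp

text \<open>The form times the identity has trace d times its value; passing to traces makes
  cyclicity available.\<close>

lemma tr_a2_form:
  assumes "wf_a2 I" "wf_a2 H"
  shows "poly (a2_form I H) (casimir_val d) * of_nat d =
    (\<Sum>t\<in>ks H. lk H t * (\<Sum>\<beta>\<in>cols (labels t). tr d (act I (wd \<beta> (fst t)) * wd \<beta> (snd t))))"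
  using arg_cong[OF a2_form_eq[OF assms], of "tr d"] by (simp add: tr_linear tr_one tr_sum)

text \<open>Rotating the circle by one strand turns s, t, s, t into t, s, t, s: now t encloses
  strand 2 of s.\<close>

lemma tr_wsum_join:
  "tr d (wsum (join_share s t)) = (\<Sum>\<alpha>\<in>cols (labels s). tr d (acts t (wd \<alpha> (snd s)) * wd \<alpha> (fst s)))"
proof -
  have "tr d (wsum (join_share s t)) = (\<Sum>\<beta>\<in>cols (labels t). \<Sum>\<alpha>\<in>cols (labels s).
      tr d (wd \<alpha> (fst s) * (wd \<beta> (fst t) * wd \<alpha> (snd s) * wd \<beta> (snd t))))"
    unfolding wsum_join acts_def sum_distrib_right tr_sum by (simp add: mult.assoc)
  also have "\<dots> = (\<Sum>\<alpha>\<in>cols (labels s). \<Sum>\<beta>\<in>cols (labels t).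
      tr d (wd \<beta> (fst t) * wd \<alpha> (snd s) * wd \<beta> (snd t) * wd \<alpha> (fst s)))"
    by (subst sum.swap) (simp add: tr_mult_commute[of d "wd _ (fst s)"])
  finally show ?thesis by (simp add: acts_def sum_distrib_right tr_sum)
qed

lemma tr_a2_form_swapped:
  assumes "wf_a2 I" "wf_a2 H"
  shows "poly (a2_form I H) (casimir_val d) * of_nat d =
    (\<Sum>s\<in>ks I. lk I s * (\<Sum>\<alpha>\<in>cols (labels s). tr d (act H (wd \<alpha> (snd s)) * wd \<alpha> (fst s))))"
proof -
  have "(\<Sum>t\<in>ks H. lk H t * tr d (wsum (join_share s t))) =
      (\<Sum>\<alpha>\<in>cols (labels s). tr d (act H (wd \<alpha> (snd s)) * wd \<alpha> (fst s)))" for s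
    unfolding tr_wsum_join act_def sum_distrib_right sum_distrib_left tr_sum smul_mult_left tr_linear
    by (subst sum.swap) simp
  moreover have "poly (a2_form I H) (casimir_val d) * of_nat d =
      (\<Sum>s\<in>ks I. lk I s * (\<Sum>t\<in>ks H. lk H t * tr d (wsum (join_share s t))))"
    using arg_cong[OF a2_form_smul[OF assms], of "tr d"]
    by (simp add: tr_linear tr_one tr_sum sum_distrib_left mult.assoc del: mf.scale_scale)
  ultimately show ?thesis by simp
qed

text \<open>An \<open>arch\<close> lies on strand 1, so strand 2 receives at most one letter from
  each factor, while strand 1 may receive two. Hence in both halves of orthogonality the operator of
  larger index is made to act on a second strand.\<close>

lemma keys_pp_length: "t \<in> ks (pp n) \<Longrightarrow> length (snd t) \<le> n"
proof -
  have cross: "length (snd u) \<le> a + b"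
    if "u \<in> ks (a2_cross I H)" "\<And>s. s \<in> ks I \<Longrightarrow> length (snd s) \<le> a" "\<And>s. s \<in> ks H \<Longrightarrow> length (snd s) \<le> b"
    for u I H a b
  proof -
    have "ks (a2_cross I H) \<subseteq> (\<Union>s\<in>ks I. \<Union>t\<in>ks H. {cross_share s t})"
      unfolding a2_cross_def
      by (rule order_trans[OF keys_sum], rule UN_mono[OF subset_refl],
          rule order_trans[OF keys_sum], rule UN_mono[OF subset_refl]) simp
    with that(1) obtain s t where "s \<in> ks I" "t \<in> ks H" "u = cross_share s t" by blast
    then show ?thesis using that(2)[of s] that(3)[of t] by (simp add: cross_share_def)
  qed
  have pfac: "length (snd s) \<le> 1" if "s \<in> ks (pfac m)" for s m
  proof -
    have "ks (a2_scale z a2_one) \<subseteq> {([], [])}" for z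
      by (simp add: a2_scale_def a2_one_def)
    then have "ks (pfac m) \<subseteq> {([0], [0]), ([0, 0], []), ([], [])}"
      unfolding pfac_def using keys_add[of "bridge - arch"] keys_diff[of bridge arch]
      by (fastforce simp: bridge_def arch_def)
    then show ?thesis using that by auto
  qed
  have "u \<in> ks (foldr (\<lambda>m acc. a2_cross (pfac m) acc) ms a2_one) \<Longrightarrow> length (snd u) \<le> length ms" for ms u
  proof (induction ms arbitrary: u)
    case Nil
    then show ?case by (simp add: a2_one_def)
  next
    case (Cons m ms)
    have "length (snd u) \<le> 1 + length ms"
      by (rule cross[of u "pfac m" "foldr (\<lambda>m acc. a2_cross (pfac m) acc) ms a2_one"])
        (use Cons pfac in auto)
    then show ?case by simp
  qed
  then show "t \<in> ks (pp n) \<Longrightarrow> length (snd t) \<le> n" unfolding pp_def by fastforce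
qed

lemma pp_orthogonal:
  assumes "n \<noteq> k"
  shows "a2_form (pp n) (pp k) = 0"
proof (rule poly_casimir_zero_imp[of 0])
  fix d :: nat assume "d > 0"
  have kill: "pop m (wd \<beta> (snd t)) = 0" if "t \<in> ks (pp l)" "l < m" for t l m \<beta>
    using that keys_pp_length[OF that(1)] by (intro pop_kills_fil[OF fil_wd]) simp
  have "poly (a2_form (pp n) (pp k)) (casimir_val d) * of_nat d = 0"
  proof (cases "n < k")
    case True
    then show ?thesis
      by (simp add: tr_a2_form_swapped wf_a2_pp act_pp kill tr_linear)
  next
    case False
    then have "k < n" using assms by simp
    then show ?thesis
      by (simp add: tr_a2_form wf_a2_pp act_pp tr_pop kill tr_linear)
  qed
  then show "poly (a2_form (pp n) (pp k)) (casimir_val d) = 0" using \<open>d > 0\<close> by simp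
qed

section \<open>Hermitian adjoints and positivity\<close>

lift_definition dag :: "mfam \<Rightarrow> mfam" is "\<lambda>A d i k. cnj (A d k i)" by auto

lemma dag_mult: "dag (X * Z) = dag Z * dag X"
  by transfer (simp add: mmul_def fun_eq_iff mult.commute)

lemma dag_add: "dag (X + Z) = dag X + dag Z"
  by transfer simp

lemma dag_diff: "dag (X - Z) = dag X - dag Z"
  by transfer simp

lemma dag_zero: "dag 0 = 0"
  by transfer simp

lemma dag_one: "dag 1 = 1"
  by transfer (auto simp: mid_def fun_eq_iff)

lemma dag_sum: "dag (\<Sum>s\<in>S. f s) = (\<Sum>s\<in>S. dag (f s))"
  by (induction S rule: infinite_finite_induct) (simp_all add: dag_add dag_zero)

lemma dag_cst: "dag (cst z \<bullet> X) = cst (cnj z) \<bullet> dag X"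
  by transfer simp

text \<open>\<open>eig n\<close> has real coefficients and the Casimir values are real; a general
  polynomial would be conjugated.\<close>

lemma dag_eig: "dag (eig n \<bullet> X) = eig n \<bullet> dag X"
  by transfer (simp add: eig_def casimir_val_def)

lemma dag_xg: "dag (xg a) = xg a"
proof -
  have ef: "dag fe = ff" "dag ff = fe" and h: "dag fh = fh"
    by (transfer, auto simp: fun_eq_iff jplus_def jminus_def jz_def)+
  show ?thesis
    by (cases a; rule mfam_eqI) (simp_all add: dag_cst dag_add dag_diff ef h entry_simps algebra_simps)
qed

lemma dag_wd: "dag (wd \<phi> w) = wd \<phi> (rev w)"
  by (induction w) (simp_all add: dag_one dag_mult dag_xg)

lemma dag_pop: "dag (pop n X) = pop n (dag X)"
proof -
  have "dag (yop X) = yop (dag X)" for X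
    by (simp add: yop_def dag_sum dag_mult dag_xg mult.assoc)
  then show ?thesis by (induction n) (simp_all add: dag_diff dag_eig)
qed

lemma tr_dag: "tr d (X * dag X) = of_real (\<Sum>i<d. \<Sum>k<d. (cmod (entry X d i k))\<^sup>2)"
  by (simp add: tr_def times_mfam.rep_eq mmul_def dag.rep_eq complex_norm_square[unfolded of_real_power])

text \<open>The value of p_n at spin k: the product of \<open>eig k - eig m\<close> over m <
  n.\<close>

definition mu :: "nat \<Rightarrow> nat \<Rightarrow> real" where
  "mu n k = (\<Prod>m<n. (real (m * (m + 1)) - real (k * (k + 1))) / 2)"

lemma mu_nonzero: "n \<le> k \<Longrightarrow> mu n k \<noteq> 0"
proof -
  assume "n \<le> k"
  have "m * (m + 1) < k * (k + 1)" if "m < n" for m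
    using that \<open>n \<le> k\<close> by (intro mult_strict_mono) auto
  then have "real (m * (m + 1)) < real (k * (k + 1))" if "m < n" for m
    using that of_nat_less_iff by blast
  then show ?thesis unfolding mu_def by fastforce
qed

lemma pop_eigenvector:
  assumes "yop Z = eig k \<bullet> Z"
  shows "pop n Z = cst (of_real (mu n k)) \<bullet> Z"
proof (induction n)
  case (Suc n)
  have "pop (Suc n) Z = cst (of_real (mu n k)) \<bullet> (eig k - eig n) \<bullet> Z"
    by (simp add: Suc yop_smul assms mf.scale_left_diff_distrib mf.scale_right_diff_distrib mult.commute del: mf.scale_scale)
      (simp add: mult.commute)
  also have "eig k - eig n = cst (of_real ((real (n * (n + 1)) - real (k * (k + 1))) / 2))"
    by (simp add: eig_def field_simps)
  finally show ?case by (simp add: mu_def mult.commute)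
qed (simp add: mu_def)

text \<open>Since p_(k+1) kills X, p_k X is an eigenvector of Y for \<open>eig k\<close>, and p_k
  applied twice is p_k times \<open>mu k k\<close>. One of the two copies moves across the trace to
  the adjoint.\<close>

lemma tr_pop_dag:
  assumes "fil k X"
  shows "of_real (mu k k) * tr d (pop k X * dag X) = of_real (\<Sum>i<d. \<Sum>l<d. (cmod (entry (pop k X) d i l))\<^sup>2)"
proof -
  have "pop (Suc k) X = 0" using assms by (rule pop_kills_fil) simp
  then have "pop k (pop k X) = cst (of_real (mu k k)) \<bullet> pop k X"
    by (intro pop_eigenvector) simp
  then have "of_real (mu k k) * tr d (pop k X * dag X) = tr d (pop k (pop k X) * dag X)"
    by (simp add: tr_linear)
  then show ?thesis unfolding tr_pop dag_pop[symmetric] tr_dag .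
qed

section \<open>Powers of J_+ as highest weight vectors\<close>

lemma fh_power: "fh * fe ^ k = fe ^ k * fh + cst (of_nat k) \<bullet> fe ^ k"
proof (induction k)
  case (Suc k)
  have "fh * fe ^ Suc k = fe * (fh * fe ^ k) + fe ^ Suc k"
    by (simp add: he_commute distrib_right flip: mult.assoc)
  then show ?case by (simp add: Suc distrib_left cst_add mult.assoc add.commute)
qed simp

text \<open>Each exchange of \<open>ff\<close> with a factor \<open>fe\<close> costs 2
  \<open>fh\<close>; carrying \<open>fh\<close> past the j copies to its right adds j, and twice the
  sum of j from 0 to k is k(k+1).\<close>

lemma ff_power: "ff * fe ^ Suc k = fe ^ Suc k * ff - cst (of_nat (Suc k)) \<bullet> (cst 2 \<bullet> (fe ^ k * fh) + cst (of_nat k) \<bullet> fe ^ k)"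
proof (induction k)
  case 0
  show ?case by (simp add: ef_commute)
next
  case (Suc k)
  have "ff * fe ^ Suc (Suc k) = fe * (ff * fe ^ Suc k) - cst 2 \<bullet> (fh * fe ^ Suc k)"
    using arg_cong[OF ef_commute, of "\<lambda>A. A * fe ^ Suc k"]
    by (simp add: distrib_right mult.assoc)
  also have "\<dots> = fe ^ Suc (Suc k) * ff - cst (of_nat (Suc (Suc k))) \<bullet> (cst 2 \<bullet> (fe ^ Suc k * fh) + cst (of_nat (Suc k)) \<bullet> fe ^ Suc k)"
    unfolding Suc fh_power
    by (rule mfam_eqI) (simp add: right_diff_distrib distrib_left entry_simps mult.assoc field_simps)
  finally show ?case .
qed

text \<open>\<open>fe ^ k\<close> is a highest weight vector of weight k for the adjoint action,
  hence of spin k. The computation brings the factors \<open>fe\<close> to the left on both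
  sides.\<close>

lemma yop_fe_power: "yop (fe ^ k) = eig k \<bullet> fe ^ k"
proof -
  have "yop X = cst (1/2) \<bullet> (fe * X * ff + ff * X * fe) + fh * X * fh" for X
    by (rule mfam_eqI) (simp add: yop_def sum_col entry_simps distrib_left distrib_right
        left_diff_distrib right_diff_distrib field_simps)
  moreover have "ff * fe ^ k * fe = ff * fe ^ Suc k"
    by (simp add: mult.assoc power_commutes)
  moreover have "fe * fe ^ k * ff = fe ^ Suc k * ff" by simp
  ultimately have "yop (fe ^ k) = cst (1/2) \<bullet> (fe ^ Suc k * ff + ff * fe ^ Suc k) + (fh * fe ^ k) * fh"
    by simp
  moreover have "eig k \<bullet> fe ^ k = fe ^ Suc k * ff + fe ^ k * fh * fh - fe ^ k * fh - cst (of_nat (k * (k + 1)) / 2) \<bullet> fe ^ k"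
  proof -
    have "eig k = [:0, 1:] - cst (of_nat (k * (k + 1)) / 2)" by (simp add: eig_def)
    then have "eig k \<bullet> fe ^ k = fe ^ k * ([:0, 1:] \<bullet> 1) - cst (of_nat (k * (k + 1)) / 2) \<bullet> fe ^ k"
      by (simp only: mf.scale_left_diff_distrib) simp
    also have "[:0, 1:] \<bullet> 1 = fe * ff + fh * fh - fh"
      unfolding casimir_efh[symmetric] ef_commute by (rule mfam_eqI) (simp add: entry_simps)
    finally show ?thesis
      by (simp add: distrib_left right_diff_distrib power_commutes flip: mult.assoc)
  qed
  ultimately show ?thesis
    unfolding ff_power fh_power
    by (intro mfam_eqI) (simp only: entry_simps distrib_right smul_mult_left, simp add: field_simps)
qed

lemma entry_fe_power: "i + k < d \<Longrightarrow> entry (fe ^ k) d i (i + k) \<noteq> 0"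
proof (induction k arbitrary: i)
  case 0
  then show ?case by (simp add: one_mfam.rep_eq mid_def)
next
  case (Suc k)
  have "entry (fe ^ Suc k) d i (i + Suc k) =
      (\<Sum>j<d. if j = Suc i then jplus d i (Suc i) * entry (fe ^ k) d (Suc i) (Suc i + k) else 0)"
    unfolding power_Suc times_mfam.rep_eq mmul_def fe.rep_eq
    by (rule sum.cong) (auto simp: jplus_def)
  also have "\<dots> = jplus d i (Suc i) * entry (fe ^ k) d (Suc i) (Suc i + k)"
    using Suc.prems by simp
  finally show ?case using Suc.IH[of "Suc i"] Suc.prems by (simp add: jplus_def)
qed

text \<open>\<open>fe\<close> is x_1 + i x_2, so \<open>fe ^ k\<close> is a combination of words of
  length k. Were all of them killed, p_k would kill \<open>fe ^ k\<close>, on which it is the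
  nonzero scalar \<open>mu k k\<close>; and k < d keeps that power nonzero.\<close>

lemma pop_word_nonzero:
  assumes "k < d"
  shows "\<exists>\<phi>\<in>cols {..<k}. \<exists>i<d. \<exists>l<d. entry (pop k (wd \<phi> [0..<k])) d i l \<noteq> 0"
proof (rule ccontr)
  assume "\<not> ?thesis"
  then have z: "entry (pop k (wd \<phi> [0..<k])) d i l = 0" if "\<phi> \<in> cols {..<k}" for \<phi> i l
    using that entry_outside by blast
  have words: "entry (pop k (prod_list (map xg as))) d i l = 0" if "length as = k" for as i l
  proof -
    let ?\<phi> = "restrict (\<lambda>m. as ! m) {..<k}"
    have "map (\<lambda>m. xg (?\<phi> m)) [0..<k] = map xg as"
      using that by (intro nth_equalityI) auto
    then have "wd ?\<phi> [0..<k] = prod_list (map xg as)" unfolding wd_def by simp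
    moreover have "?\<phi> \<in> cols {..<k}" by (simp add: cols_def)
    ultimately show ?thesis using z by metis
  qed
  have fe: "fe = xg C1 + cst \<i> \<bullet> xg C2"
    by (rule mfam_eqI) (simp add: entry_simps field_simps)
  \<comment> \<open>The power of \<open>fe\<close> is opened one factor at a time, from the left,
    into the word \<open>as\<close>.\<close>
  have "entry (pop k (prod_list (map xg as) * fe ^ j)) d i l = 0" if "length as + j = k" for as j i l
    using that
  proof (induction j arbitrary: as)
    case 0
    then show ?case using words by simp
  next
    case (Suc j)
    have "prod_list (map xg as) * fe ^ Suc j = prod_list (map xg (as @ [C1])) * fe ^ j
        + cst \<i> \<bullet> (prod_list (map xg (as @ [C2])) * fe ^ j)"
      unfolding power_Suc by (subst (1) fe) (simp del: xg.simps add: distrib_left distrib_right mult.assoc)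
    then show ?case using Suc.IH[of "as @ [C1]"] Suc.IH[of "as @ [C2]"] Suc.prems
      by (simp add: pop_add pop_smul entry_simps)
  qed
  from this[of "[]" k 0 k] have "entry (pop k (fe ^ k)) d 0 k = 0" by simp
  then show False
    using entry_fe_power[of 0 k d] assms mu_nonzero[of k k]
    by (simp add: pop_eigenvector[OF yop_fe_power] entry_simps)
qed

lemma tr_pop_words_nonzero:
  assumes "k < d"
  shows "(\<Sum>\<phi>\<in>cols {..<k}. tr d (pop k (wd \<phi> [0..<k]) * wd \<phi> (rev [0..<k]))) \<noteq> 0"
proof
  define N where "N \<phi> = (\<Sum>i<d. \<Sum>l<d. (cmod (entry (pop k (wd \<phi> [0..<k])) d i l))\<^sup>2)" for \<phi>
  have fin: "finite (cols {..<k})" unfolding cols_def by (intro finite_PiE) auto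
  assume *: "(\<Sum>\<phi>\<in>cols {..<k}. tr d (pop k (wd \<phi> [0..<k]) * wd \<phi> (rev [0..<k]))) = 0"
  have "of_real (mu k k) * tr d (pop k (wd \<phi> [0..<k]) * wd \<phi> (rev [0..<k])) = of_real (N \<phi>)" for \<phi>
    unfolding N_def dag_wd[symmetric] using fil_wd[of "[0..<k]" \<phi>] by (intro tr_pop_dag) simp
  then have "complex_of_real (\<Sum>\<phi>\<in>cols {..<k}. N \<phi>) =
      of_real (mu k k) * (\<Sum>\<phi>\<in>cols {..<k}. tr d (pop k (wd \<phi> [0..<k]) * wd \<phi> (rev [0..<k])))"
    by (simp add: sum_distrib_left)
  then have "(\<Sum>\<phi>\<in>cols {..<k}. N \<phi>) = 0" unfolding * by (simp flip: of_real_sum)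
  moreover have nn: "N \<phi> \<ge> 0" for \<phi> unfolding N_def by (intro sum_nonneg) auto
  ultimately have N0: "N \<phi> = 0" if "\<phi> \<in> cols {..<k}" for \<phi>
    using that fin by (simp add: sum_nonneg_eq_0_iff)
  obtain \<phi> i l where "\<phi> \<in> cols {..<k}" "i < d" "l < d" "entry (pop k (wd \<phi> [0..<k])) d i l \<noteq> 0"
    using pop_word_nonzero[OF assms] by blast
  with N0[of \<phi>] show False
    unfolding N_def by (auto simp: sum_nonneg_eq_0_iff sum_nonneg)
qed

section \<open>Spanning and independence\<close>

lemma act_expansion: "act (\<Sum>n<N. a2_cross (cpoly (q n)) (pp n)) X = (\<Sum>n<N. q n \<bullet> pop n X)"
  by (simp add: act_sum act_cross act_cpoly act_pp)

lemma wf_a2_expansion: "wf_a2 (\<Sum>n<N. a2_cross (cpoly (q n)) (pp n))"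
  by (intro wf_a2_sum wf_a2_cross wf_a2_cpoly wf_a2_pp)

lemma pp_spanning:
  assumes "wf_a2 I"
  shows "\<exists>N q. a2_sim I (\<Sum>n<N. a2_cross (cpoly (q n)) (pp n))"
proof -
  obtain N q where "\<And>X. act I X = (\<Sum>n<N. q n \<bullet> pop n X)"
    using good_expansion[OF good_act[OF assms]] by blast
  then have "a2_sim I (\<Sum>n<N. a2_cross (cpoly (q n)) (pp n))"
    using assms wf_a2_expansion by (intro a2_sim_if_act_eq) (simp_all add: act_expansion)
  then show ?thesis by blast
qed

text \<open>Pairing with the k-fold bridge isolates \<open>q k\<close>: smaller indices vanish by
  induction, and p_n with n > k kills words of length k. The remaining trace is nonzero in every
  dimension above k, which gives \<open>q k\<close> infinitely many roots.\<close>

lemma pp_independent: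
  assumes "a2_sim (\<Sum>n<N. a2_cross (cpoly (q n)) (pp n)) 0" "k < N"
  shows "q k = 0"
  using assms(2)
proof (induction k rule: less_induct)
  case (less k)
  let ?J = "\<Sum>n<N. a2_cross (cpoly (q n)) (pp n)"
  \<comment> \<open>Reversing strand 2 is the nesting order of y^k and makes the second word the
    adjoint of the first.\<close>
  let ?H = "([0..<k], rev [0..<k])"
  let ?S = "\<lambda>d. \<Sum>\<phi>\<in>cols {..<k}. tr d (pop k (wd \<phi> [0..<k]) * wd \<phi> (rev [0..<k]))"
  have wf: "wf_share ?H"
  proof -
    have "count_list [0..<k] l = 1" if "l < k" for l
      using that distinct_count_atmost_1[of "[0..<k]"] by (simp add: count_mset del: mset_upt)
    then show ?thesis by (auto simp: wf_share_def)
  qed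
  have J: "act ?J (wd \<phi> [0..<k]) = q k \<bullet> pop k (wd \<phi> [0..<k])" for \<phi>
  proof -
    have "q n \<bullet> pop n (wd \<phi> [0..<k]) = 0" if "n < N" "n \<noteq> k" for n
    proof (cases "n < k")
      case True
      then show ?thesis using less that by simp
    next
      case False
      then have "pop n (wd \<phi> [0..<k]) = 0"
        using that fil_wd[of "[0..<k]" \<phi>] by (intro pop_kills_fil[of k]) auto
      then show ?thesis by simp
    qed
    then have "(\<Sum>n<N. q n \<bullet> pop n (wd \<phi> [0..<k])) = (\<Sum>n<N. if n = k then q k \<bullet> pop k (wd \<phi> [0..<k]) else 0)"
      by (intro sum.cong) auto
    then show ?thesis using less.prems by (simp add: act_expansion)
  qed
  show "q k = 0"
  proof (rule poly_casimir_zero_imp[of k])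
    fix d assume "k < d"
    have "a2_form ?J (Poly_Mapping.single ?H 1) = a2_form 0 (Poly_Mapping.single ?H 1)"
      using assms(1) wf unfolding a2_sim_def by blast
    then have "a2_form ?J (Poly_Mapping.single ?H 1) = 0" by (simp add: a2_form_def)
    moreover have "labels ?H = {..<k}" by (auto simp: labels_def)
    ultimately have "(\<Sum>\<phi>\<in>cols {..<k}. tr d (act ?J (wd \<phi> [0..<k]) * wd \<phi> (rev [0..<k]))) = 0"
      using tr_a2_form[OF wf_a2_expansion[of q N] wf_a2_single[OF wf, of 1], of d] by simp
    then have "poly (q k) (casimir_val d) * ?S d = 0"
      by (simp add: J tr_linear sum_distrib_left)
    then show "poly (q k) (casimir_val d) = 0" using tr_pop_words_nonzero[OF \<open>k < d\<close>] by simp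
  qed
qed

theorem theorem5:
  shows "(\<forall>I. wf_a2 I \<longrightarrow>
            (\<exists>N (q :: nat \<Rightarrow> complex poly). a2_sim I (\<Sum>n<N. a2_cross (cpoly (q n)) (pp n))))
       \<and> (\<forall>N (q :: nat \<Rightarrow> complex poly).
            a2_sim (\<Sum>n<N. a2_cross (cpoly (q n)) (pp n)) 0 \<longrightarrow> (\<forall>n<N. q n = 0))
       \<and> (\<forall>n k. n \<noteq> k \<longrightarrow> a2_form (pp n) (pp k) = 0)"
  using pp_spanning pp_independent pp_orthogonal by blast

end
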